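(* Let $\mathtt V=\{(V_n),(\tau)\}$ be a $\mathrm{FinSet}$-representation. Suppose that there is a basis $\{e_\alpha\}_{\alpha\in\mathcal A_n}$ for each $V_n$ and subsets $\{S_\alpha\subseteq[n]\}_{\alpha\in\mathcal A_n}$ of sizes $|S_\alpha|\le d$ (with $d$ independent of $n$ and $\alpha$) such that $\tau(f)e_\alpha=\tau(h)e_\alpha$ whenever $f|_{S_\alpha}=h|_{S_\alpha}$, for all $f,h:[n]\to[m]$. Endow each $V_n$ with the $\ell_1$-norm $\|\cdot\|_1$ with respect to this basis, and suppose $\|\tau(f)e_\alpha\|_1\le1$ for all $f:[n]\to[m]$ and all $\alpha\in\mathcal A_n$. Let $(\Omega_n\subseteq V_n)_n$ be a sequence of compact sets satisfying $\tau(f)\Omega_m\subseteq\Omega_n$ for all $f:[m]\to[n]$ and $\sup_n\sup_{x\in\Omega_n}\|x\|_1<\infty$. Consider the map from $\varinjlim_{\mathcal Z(\mathtt V^\star)}\mathcal P(\Omega_n)^{\mathfrak S_n}$ to $\varprojlim_{\mathcal D(\mathtt V^\star)}\mathcal P(\Omega_m)^{\mathfrak S_m}$ sending $$\left(\mathrm{sym}_N^{\mathcal Z(\mathtt V^\star)}\mu_n\right)_{N\ge n}\ \mapsto\ \big(\mathrm{Law}(\tau(F_{m,n})X)\big)_m,$$ where $X\sim\mu_n$ is independent of the uniformly random map $F_{m,n}:[n]\to[m]$. This map has a dense image in $W_1$-distance with respect to $\|\cdot\|_1$; that is, for any $(\mu_m)\in\varprojlim_{\mathcal D(\mathtt V^\star)}\mathcal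 P(\Omega_m)^{\mathfrak S_m}$ there exist elements $(\mu_m^{(i)})_m$, $i=1,2,\dots$, of the image with $\lim_{i\to\infty}W_1(\mu_m,\mu_m^{(i)})=0$ for each $m$. More precisely, for any $\mu_n\in\mathcal P(V_n)^{\mathfrak S_n}$ and any $m\mid n$ we have $$W_1\big(\mathrm{Law}(\tau(d_{m,n})X),\mathrm{Law}(\tau(F_{m,n})X)\big)\le 2d\sqrt{\frac{m(m-1)}{n/m}}\ \mathbb E_{\mu_n}\big[\|X\|_1\big]$$ and $$\big\|\mathbb E\,\tau(d_{m,n})X-\mathbb E\,\tau(F_{m,n})X\big\|_1\le\frac{d(d-1)}{n}\ \mathbb E_{\mu_n}\big[\|X\|_1\big],$$ where $X\sim\mu_n$ is independent of $F_{m,n}$.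
   Context: Dimension indices $n,m,N,M$ are positive integers; $[n]=\{1,\dots,n\}$; $n\mid N$ is divisibility; $\mathfrak S_n$ is the symmetric group on $[n]$. A $\mathrm{FinSet}$-representation $\mathtt V=\{(V_n),(\tau)\}$ is a sequence of finite-dimensional real vector spaces $V_n$ together with a linear map $\tau(f):V_n\to V_m$ for each map $f:[n]\to[m]$, such that $\tau(\mathrm{id}_{[n]})=\mathrm{id}_{V_n}$ and $\tau(f_1\circ f_2)=\tau(f_1)\circ\tau(f_2)$ whenever the composition is defined. Each $V_n$ carries an inner product for which $\mathfrak S_n$ acts orthogonally via $\sigma\cdot x=\tau(\sigma)x$; $^\star$ denotes the adjoint with respect to these inner products. For $n\le N$, $\iota_{N,n}:[n]\hookrightarrow[N]$ is the inclusion; for $N=nk$, $d_{n,N}:[N]\to[n]$ is the standard equipartition $d_{n,nk}(k(i-1)+j)=i$ for $i\in[n]$, $j\in[k]$. $\mathtt V^\star$ denotes $(V_n)$ with the maps $\tau(f)^\star$. $\mathcal Z(\mathtt V^\star)$ is the sequence $(V_n)$ with embeddings $\tau(\iota_{N,n}):V_n\to V_N$ for $n\le N$; $\mathcal D(\mathtt V^\star)$ is the sequence $(V_n)$ with embeddings $\tau(d_{n,N})^\star:V_n\to V_N$ for $n\mid N$ (so the adjoint projections are $\tau(d_{n,N}):V_N\to V_n$). $\mathcal P(\Omega)$ is the set of Borel probability measures on $\Omega$ and $\mathcal P(\Omega)^{\mathfrak S_n}$ the $\mathfrak S_n$-invariant ones. $\varprojlim_{\mathcal D(\mathtt V^\star)}\mathcal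 P(\Omega_m)^{\mathfrak S_m}$ is the set of sequences $(\mu_m)_m$, $\mu_m\in\mathcal P(\Omega_m)^{\mathfrak S_m}$, such that the pushforward of $\mu_M$ under $\tau(d_{m,M})$ is $\mu_m$ for all $m\mid M$. For $n\le N$, $\mathrm{sym}_N^{\mathcal Z(\mathtt V^\star)}\mu_n=\mathrm{Law}(\Pi_N\cdot\tau(\iota_{N,n})X)$ with $X\sim\mu_n$ and $\Pi_N\in\mathfrak S_N$ independent and uniformly random. $\varinjlim_{\mathcal Z(\mathtt V^\star)}\mathcal P(\Omega_n)^{\mathfrak S_n}$ is $\bigsqcup_n\mathcal P(\Omega_n)^{\mathfrak S_n}$ modulo the equivalence relation generated by $\mu_n\sim\mathrm{sym}_N^{\mathcal Z(\mathtt V^\star)}\mu_n$ for $n\le N$; the class of $\mu_n$ is written $(\mathrm{sym}_N^{\mathcal Z(\mathtt V^\star)}\mu_n)_{N\ge n}$. $W_1(\mu,\nu)=\inf\mathbb E\|X-Y\|_1$ over couplings $(X,Y)$ of $\mu,\nu$. If $\mathbb E_{\mu_n}\|X\|_1=\infty$ the error bounds are regarded as vacuous. *)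

theory Defs
  imports "HOL-Probability.Probability"
begin

text \<open>All dimension indices are positive. A map \<open>[n] \<rightarrow> [m]\<close> is an extensional function, so that
  equality of HOL functions is equality of maps.\<close>

definition fmaps :: "nat \<Rightarrow> nat \<Rightarrow> (nat \<Rightarrow> nat) set" where
  "fmaps n m = ({1..n} \<rightarrow>\<^sub>E {1..m})"

definition perms :: "nat \<Rightarrow> (nat \<Rightarrow> nat) set" where
  "perms n = {\<sigma> \<in> fmaps n n. bij_betw \<sigma> {1..n} {1..n}}"

text \<open>The inclusion of \<open>[n]\<close> in \<open>[N]\<close> for every \<open>N \<ge> n\<close>; for \<open>N = n\<close> it is the identity of \<open>[n]\<close>.\<close>

definition incl :: "nat \<Rightarrow> nat \<Rightarrow> nat" where
  "incl n = (\<lambda>i\<in>{1..n}. i)"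

text \<open>For \<open>N = n * k\<close> this sends \<open>k * (i - 1) + j\<close> to \<open>i\<close>, for \<open>i \<in> [n]\<close> and \<open>j \<in> [k]\<close>.\<close>

definition equipart :: "nat \<Rightarrow> nat \<Rightarrow> nat \<Rightarrow> nat" where
  "equipart n N = (\<lambda>x\<in>{1..N}. (x - 1) div (N div n) + 1)"

text \<open>The spaces \<open>V n\<close> are finite-dimensional subspaces, of unrelated and possibly unbounded dimensions,
  of a separable Hilbert space that only serves as a common carrier type. This is no restriction:
  any sequence of finite-dimensional inner product spaces embeds isometrically in \<open>\<ell>\<^sup>2\<close> as mutually
  orthogonal subspaces. The inner product on \<open>V n\<close> is the inherited one, and the inherited topology is
  the usual one of a finite-dimensional space. The operator \<open>\<tau> n m f\<close> is only constrained
  on \<open>V n\<close>.\<close>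

locale finset_rep =
  fixes V :: "nat \<Rightarrow> 'a::{real_inner, banach, second_countable_topology} set"
    and \<tau> :: "nat \<Rightarrow> nat \<Rightarrow> (nat \<Rightarrow> nat) \<Rightarrow> 'a \<Rightarrow> 'a"
  assumes fin_dim: "n > 0 \<Longrightarrow> \<exists>B. finite B \<and> V n = span B"
    and maps_to: "n > 0 \<Longrightarrow> m > 0 \<Longrightarrow> f \<in> fmaps n m \<Longrightarrow> x \<in> V n \<Longrightarrow> \<tau> n m f x \<in> V m"
    and map_add: "n > 0 \<Longrightarrow> m > 0 \<Longrightarrow> f \<in> fmaps n m \<Longrightarrow> x \<in> V n \<Longrightarrow> y \<in> V n \<Longrightarrow>
      \<tau> n m f (x + y) = \<tau> n m f x + \<tau> n m f y"
    and map_scaleR: "n > 0 \<Longrightarrow> m > 0 \<Longrightarrow> f \<in> fmaps n m \<Longrightarrow> x \<in> V n \<Longrightarrow>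
      \<tau> n m f (c *\<^sub>R x) = c *\<^sub>R \<tau> n m f x"
    and map_id: "n > 0 \<Longrightarrow> x \<in> V n \<Longrightarrow> \<tau> n n (incl n) x = x"
    and map_comp: "n > 0 \<Longrightarrow> m > 0 \<Longrightarrow> k > 0 \<Longrightarrow> g \<in> fmaps n m \<Longrightarrow> f \<in> fmaps m k \<Longrightarrow> x \<in> V n \<Longrightarrow>
      \<tau> n k (compose {1..n} f g) x = \<tau> m k f (\<tau> n m g x)"
    and orthogonal: "n > 0 \<Longrightarrow> \<sigma> \<in> perms n \<Longrightarrow> x \<in> V n \<Longrightarrow> y \<in> V n \<Longrightarrow>
      \<tau> n n \<sigma> x \<bullet> \<tau> n n \<sigma> y = x \<bullet> y"

definition basis_of :: "'i set \<Rightarrow> ('i \<Rightarrow> 'a::real_vector) \<Rightarrow> 'a set \<Rightarrow> bool" where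
  "basis_of A e W \<longleftrightarrow> inj_on e A \<and> independent (e ` A) \<and> span (e ` A) = W"

definition l1_norm :: "'i set \<Rightarrow> ('i \<Rightarrow> 'a::real_vector) \<Rightarrow> 'a \<Rightarrow> real" where
  "l1_norm A e x = (\<Sum>\<alpha>\<in>A. \<bar>representation (e ` A) x (e \<alpha>)\<bar>)"

abbreviation borel_on :: "'a::topological_space set \<Rightarrow> 'a measure" where
  "borel_on W \<equiv> restrict_space borel W"

definition borel_probs :: "'a::topological_space set \<Rightarrow> 'a measure set" where
  "borel_probs W = {\<mu>. prob_space \<mu> \<and> sets \<mu> = sets (borel_on W)}"

definition inv_probs ::
  "(nat \<Rightarrow> nat \<Rightarrow> (nat \<Rightarrow> nat) \<Rightarrow> 'a \<Rightarrow> 'a) \<Rightarrow> (nat \<Rightarrow> 'a::topological_space set) \<Rightarrow> nat \<Rightarrow> 'a measure set" where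
  "inv_probs \<tau> \<Omega> n =
     {\<mu> \<in> borel_probs (\<Omega> n). \<forall>\<sigma>\<in>perms n. distr \<mu> (borel_on (\<Omega> n)) (\<tau> n n \<sigma>) = \<mu>}"

text \<open>\<open>det_law \<tau> \<Omega> n m f \<mu>\<close> is the law of \<open>\<tau>(f) X\<close> for \<open>X \<sim> \<mu>\<close>; \<open>rand_law \<tau> \<Omega> n m \<mu>\<close> is the law of
  \<open>\<tau>(F) X\<close> for \<open>F\<close> uniform on the maps \<open>[n] \<rightarrow> [m]\<close> and independent of \<open>X\<close>; \<open>sym_law \<tau> \<Omega> n N \<mu>\<close> is the
  law of \<open>\<Pi> \<cdot> \<tau>(\<iota>) X\<close> for \<open>\<Pi>\<close> a uniform permutation of \<open>[N]\<close> independent of \<open>X\<close>. Laws are Borel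
  measures on the target set \<open>\<Omega> m\<close>, resp. \<open>\<Omega> N\<close>; taking \<open>\<Omega> = V\<close> gives laws on the whole spaces.\<close>

definition det_law ::
  "(nat \<Rightarrow> nat \<Rightarrow> (nat \<Rightarrow> nat) \<Rightarrow> 'a \<Rightarrow> 'a) \<Rightarrow> (nat \<Rightarrow> 'a::topological_space set) \<Rightarrow>
    nat \<Rightarrow> nat \<Rightarrow> (nat \<Rightarrow> nat) \<Rightarrow> 'a measure \<Rightarrow> 'a measure" where
  "det_law \<tau> \<Omega> n m f \<mu> = distr \<mu> (borel_on (\<Omega> m)) (\<tau> n m f)"

definition rand_law ::
  "(nat \<Rightarrow> nat \<Rightarrow> (nat \<Rightarrow> nat) \<Rightarrow> 'a \<Rightarrow> 'a) \<Rightarrow> (nat \<Rightarrow> 'a::topological_space set) \<Rightarrow>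
    nat \<Rightarrow> nat \<Rightarrow> 'a measure \<Rightarrow> 'a measure" where
  "rand_law \<tau> \<Omega> n m \<mu> =
     distr (uniform_count_measure (fmaps n m) \<Otimes>\<^sub>M \<mu>) (borel_on (\<Omega> m)) (\<lambda>(f, x). \<tau> n m f x)"

definition sym_law ::
  "(nat \<Rightarrow> nat \<Rightarrow> (nat \<Rightarrow> nat) \<Rightarrow> 'a \<Rightarrow> 'a) \<Rightarrow> (nat \<Rightarrow> 'a::topological_space set) \<Rightarrow>
    nat \<Rightarrow> nat \<Rightarrow> 'a measure \<Rightarrow> 'a measure" where
  "sym_law \<tau> \<Omega> n N \<mu> =
     distr (uniform_count_measure (perms N) \<Otimes>\<^sub>M \<mu>) (borel_on (\<Omega> N))
       (\<lambda>(\<sigma>, x). \<tau> N N \<sigma> (\<tau> n N (incl n) x))"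

definition proj_lim ::
  "(nat \<Rightarrow> nat \<Rightarrow> (nat \<Rightarrow> nat) \<Rightarrow> 'a \<Rightarrow> 'a) \<Rightarrow> (nat \<Rightarrow> 'a::topological_space set) \<Rightarrow>
    (nat \<Rightarrow> 'a measure) set" where
  "proj_lim \<tau> \<Omega> =
     {\<mu> \<in> (\<Pi>\<^sub>E m\<in>{0<..}. inv_probs \<tau> \<Omega> m).
        \<forall>m M. 0 < m \<and> 0 < M \<and> m dvd M \<longrightarrow> det_law \<tau> \<Omega> M m (equipart m M) (\<mu> M) = \<mu> m}"

definition ind_union ::
  "(nat \<Rightarrow> nat \<Rightarrow> (nat \<Rightarrow> nat) \<Rightarrow> 'a \<Rightarrow> 'a) \<Rightarrow> (nat \<Rightarrow> 'a::topological_space set) \<Rightarrow>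
    (nat \<times> 'a measure) set" where
  "ind_union \<tau> \<Omega> = (SIGMA n:{0<..}. inv_probs \<tau> \<Omega> n)"

definition ind_step ::
  "(nat \<Rightarrow> nat \<Rightarrow> (nat \<Rightarrow> nat) \<Rightarrow> 'a \<Rightarrow> 'a) \<Rightarrow> (nat \<Rightarrow> 'a::topological_space set) \<Rightarrow>
    nat \<times> 'a measure \<Rightarrow> nat \<times> 'a measure \<Rightarrow> bool" where
  "ind_step \<tau> \<Omega> p q \<longleftrightarrow>
     (\<exists>n N \<mu>. 0 < n \<and> n \<le> N \<and> \<mu> \<in> inv_probs \<tau> \<Omega> n \<and> p = (n, \<mu>) \<and> q = (N, sym_law \<tau> \<Omega> n N \<mu>))"

definition ind_rel ::
  "(nat \<Rightarrow> nat \<Rightarrow> (nat \<Rightarrow> nat) \<Rightarrow> 'a \<Rightarrow> 'a) \<Rightarrow> (nat \<Rightarrow> 'a::topological_space set) \<Rightarrow>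
    ((nat \<times> 'a measure) \<times> (nat \<times> 'a measure)) set" where
  "ind_rel \<tau> \<Omega> =
     {(p, q). p \<in> ind_union \<tau> \<Omega> \<and> q \<in> ind_union \<tau> \<Omega> \<and> equivclp (ind_step \<tau> \<Omega>) p q}"

definition ind_lim ::
  "(nat \<Rightarrow> nat \<Rightarrow> (nat \<Rightarrow> nat) \<Rightarrow> 'a \<Rightarrow> 'a) \<Rightarrow> (nat \<Rightarrow> 'a::topological_space set) \<Rightarrow>
    (nat \<times> 'a measure) set set" where
  "ind_lim \<tau> \<Omega> = ind_union \<tau> \<Omega> // ind_rel \<tau> \<Omega>"

definition ind_class ::
  "(nat \<Rightarrow> nat \<Rightarrow> (nat \<Rightarrow> nat) \<Rightarrow> 'a \<Rightarrow> 'a) \<Rightarrow> (nat \<Rightarrow> 'a::topological_space set) \<Rightarrow>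
    nat \<Rightarrow> 'a measure \<Rightarrow> (nat \<times> 'a measure) set" where
  "ind_class \<tau> \<Omega> n \<mu> = ind_rel \<tau> \<Omega> `` {(n, \<mu>)}"

definition rand_seq ::
  "(nat \<Rightarrow> nat \<Rightarrow> (nat \<Rightarrow> nat) \<Rightarrow> 'a \<Rightarrow> 'a) \<Rightarrow> (nat \<Rightarrow> 'a::topological_space set) \<Rightarrow>
    nat \<Rightarrow> 'a measure \<Rightarrow> nat \<Rightarrow> 'a measure" where
  "rand_seq \<tau> \<Omega> n \<mu> = (\<lambda>m\<in>{0<..}. rand_law \<tau> \<Omega> n m \<mu>)"

text \<open>The map on classes; it is meaningful because \<open>rand_seq\<close> takes a single value on each class.\<close>

definition lim_map ::
  "(nat \<Rightarrow> nat \<Rightarrow> (nat \<Rightarrow> nat) \<Rightarrow> 'a \<Rightarrow> 'a) \<Rightarrow> (nat \<Rightarrow> 'a::topological_space set) \<Rightarrow>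
    (nat \<times> 'a measure) set \<Rightarrow> nat \<Rightarrow> 'a measure" where
  "lim_map \<tau> \<Omega> c = the_elem ((\<lambda>(n, \<mu>). rand_seq \<tau> \<Omega> n \<mu>) ` c)"

definition couplings :: "'a measure \<Rightarrow> 'a measure \<Rightarrow> ('a \<times> 'a) measure set" where
  "couplings \<mu> \<nu> =
     {\<pi>. prob_space \<pi> \<and> sets \<pi> = sets (\<mu> \<Otimes>\<^sub>M \<nu>) \<and> distr \<pi> \<mu> fst = \<mu> \<and> distr \<pi> \<nu> snd = \<nu>}"

definition W1 :: "('a::real_vector \<Rightarrow> real) \<Rightarrow> 'a measure \<Rightarrow> 'a measure \<Rightarrow> ennreal" where
  "W1 p \<mu> \<nu> = (INF \<pi>\<in>couplings \<mu> \<nu>. \<integral>\<^sup>+ (x, y). ennreal (p (x - y)) \<partial>\<pi>)"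

end

theory Submission
  imports Defs
begin

text \<open>All laws in the statement are uniform mixtures, over finite sets of maps, of images of \<open>\<mu>\<close>, and a map
  between finite sets whose fibres all have the same size transports uniform averages. This gives the
  compatibility of \<open>Law(\<tau>(F)X)\<close> with symmetrization and with the projections.

  For the Wasserstein bound, a uniform map \<open>f : [n] \<rightarrow> [m]\<close> is corrected to an equipartition
  \<open>equipart \<circ> \<sigma> f\<close> by moving only the excess of the fibre sizes over \<open>n/m\<close>; by the variance of the
  multinomial distribution this costs at most \<open>sqrt(n(m-1))\<close> changes on average. After composition with a
  uniform permutation each point is changed with equal probability, and the image of a basis vector
  \<open>e\<^sub>\<alpha>\<close> moves by at most \<open>2\<close>, and only if one of the at most \<open>d\<close> points of its support is changed.
  The bound on expectations compares sampling with and without replacement: the two agree unless a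
  uniform self-map of \<open>[n]\<close> has a collision on the support. Density follows by taking
  \<open>n = i!\<close>, which every \<open>m\<close> eventually divides.\<close>

section \<open>Uniform averages\<close>

text \<open>A coupling needs a first component with exactly the law of
  \<open>\<tau>(equipart) X\<close>; invariance of \<open>\<mu>\<close> supplies the maps
  \<open>equipart\<close> after a permutation for this, and these are the maps with all fibres of
  size n/m. The Wasserstein bound thus asks how far a uniform map is from such balanced maps in
  Hamming distance. The answer is a total over [n] and says nothing about a given point, whereas the
  support of a basis vector may sit where the changes concentrate; hence the extra uniform
  permutation, which leaves both marginals intact. What comes out is 2d sqrt((m-1)/n) times the mean
  norm, which is the stated bound divided by m. For the means no coupling is paid for: by linearity,
  the contributions of different permutations to a fixed basis vector cancel before a norm is taken.
  This improves the order n^(-1/2) to 1/n. Laws are compared through their values on single sets, so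
  that an identity between random images becomes one between finite averages of real
  numbers.\<close>

definition average :: "'i set \<Rightarrow> ('i \<Rightarrow> 'b::real_vector) \<Rightarrow> 'b" where
  "average I \<phi> = (\<Sum>i\<in>I. \<phi> i) /\<^sub>R real (card I)"

text \<open>The common fibre size stays under an existential quantifier because it cancels from
  every average. For nonempty finite sets the condition says that \<open>u\<close> carries the
  uniform distribution of \<open>I\<close> to that of \<open>J\<close>.\<close>

definition equifibred :: "('i \<Rightarrow> 'j) \<Rightarrow> 'i set \<Rightarrow> 'j set \<Rightarrow> bool" where
  "equifibred u I J \<longleftrightarrow> u \<in> I \<rightarrow> J \<and> (\<exists>c. \<forall>j\<in>J. card {i\<in>I. u i = j} = c)"

lemma average_cong: "(\<And>i. i \<in> I \<Longrightarrow> \<phi> i = \<psi> i) \<Longrightarrow> average I \<phi> = average I \<psi>"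
  by (simp add: average_def)

lemma average_const: "finite I \<Longrightarrow> I \<noteq> {} \<Longrightarrow> average I (\<lambda>_. c) = c"
  by (simp add: average_def sum_constant_scaleR)

lemma average_diff: "average I (\<lambda>i. \<phi> i - \<psi> i) = average I \<phi> - average I \<psi>"
  by (simp add: average_def sum_subtractf scaleR_diff_right)

lemma average_swap:
  "average I (\<lambda>i. average J (\<phi> i)) = average J (\<lambda>j. average I (\<lambda>i. \<phi> i j))"
  unfolding average_def
  by (simp add: scaleR_sum_right[symmetric] mult.commute) (metis sum.swap)

lemma average_sum: "average I (\<lambda>i. \<Sum>k\<in>K. \<phi> i k) = (\<Sum>k\<in>K. average I (\<lambda>i. \<phi> i k))"
  unfolding average_def by (subst sum.swap) (simp add: scaleR_sum_right)

lemma average_mult_left: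
  fixes k :: real
  shows "average I (\<lambda>i. k * \<phi> i) = k * average I \<phi>"
  by (simp add: average_def sum_distrib_left[symmetric])

lemma average_mono:
  fixes \<phi> \<psi> :: "'i \<Rightarrow> real"
  shows "(\<And>i. i \<in> I \<Longrightarrow> \<phi> i \<le> \<psi> i) \<Longrightarrow> average I \<phi> \<le> average I \<psi>"
  unfolding average_def by (auto intro!: divide_right_mono sum_mono simp: divide_inverse[symmetric] field_simps)

lemma average_times:
  "average (I \<times> J) \<phi> = average I (\<lambda>i. average J (\<lambda>j. \<phi> (i, j)))"
  unfolding average_def
  by (simp add: card_cartesian_product sum.cartesian_product scaleR_sum_right[symmetric])

lemma equifibred_average:
  assumes "finite I" "finite J" "I \<noteq> {}" and u: "equifibred u I J"
  shows "average I (\<lambda>i. \<phi> (u i)) = average J \<phi>"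
proof -
  obtain c where c: "\<And>j. j \<in> J \<Longrightarrow> card {i\<in>I. u i = j} = c" and uJ: "u ` I \<subseteq> J"
    using u unfolding equifibred_def by blast
  have "(\<Sum>i\<in>I. \<phi> (u i)) = (\<Sum>j\<in>J. \<Sum>i | i \<in> I \<and> u i = j. \<phi> (u i))"
    using assms uJ by (intro sum.group[symmetric]) auto
  also have "\<dots> = (\<Sum>j\<in>J. real c *\<^sub>R \<phi> j)"
  proof (rule sum.cong[OF refl])
    fix j assume "j \<in> J"
    have "(\<Sum>i | i \<in> I \<and> u i = j. \<phi> (u i)) = (\<Sum>i\<in>{i\<in>I. u i = j}. \<phi> j)"
      by (rule sum.cong) auto
    then show "(\<Sum>i | i \<in> I \<and> u i = j. \<phi> (u i)) = real c *\<^sub>R \<phi> j"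
      using c[OF \<open>j \<in> J\<close>] by (simp add: sum_constant_scaleR)
  qed
  finally have s: "(\<Sum>i\<in>I. \<phi> (u i)) = real c *\<^sub>R (\<Sum>j\<in>J. \<phi> j)"
    by (simp add: scaleR_sum_right)
  have "card I = (\<Sum>i\<in>I. 1)" by simp
  also have "\<dots> = (\<Sum>j\<in>J. \<Sum>i | i \<in> I \<and> u i = j. 1)"
    using assms uJ by (intro sum.group[symmetric]) auto
  also have "\<dots> = c * card J" using c by simp
  finally have "card I = c * card J" .
  \<comment> \<open>Nonemptiness of \<open>I\<close> excludes \<open>c = 0\<close>, so that
    \<open>c\<close> cancels between the sum and the cardinality.\<close>
  moreover from this have "c \<noteq> 0" using assms by auto
  ultimately show ?thesis
    by (simp add: average_def s)
qed

lemma bij_betw_equifibred: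
  assumes "bij_betw u I J"
  shows "equifibred u I J"
proof -
  have "card {i\<in>I. u i = j} = 1" if "j \<in> J" for j
  proof -
    obtain i where "i \<in> I" "u i = j" using assms \<open>j \<in> J\<close> unfolding bij_betw_def by blast
    then have "{i\<in>I. u i = j} = {i}" using assms by (auto simp: bij_betw_def inj_on_def)
    then show ?thesis by simp
  qed
  then show ?thesis using assms by (auto simp: equifibred_def bij_betw_def)
qed

lemma equifibred_comp:
  assumes "finite I" "finite J" and u: "equifibred u I J" and v: "equifibred v J K"
  shows "equifibred (\<lambda>i. v (u i)) I K"
proof -
  obtain c where c: "\<And>j. j \<in> J \<Longrightarrow> card {i\<in>I. u i = j} = c" and uJ: "u \<in> I \<rightarrow> J"
    using u unfolding equifibred_def by blast
  obtain c' where c': "\<And>k. k \<in> K \<Longrightarrow> card {j\<in>J. v j = k} = c'" and vK: "v \<in> J \<rightarrow> K"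
    using v unfolding equifibred_def by blast
  have "card {i\<in>I. v (u i) = k} = c' * c" if "k \<in> K" for k
  proof -
    have "{i\<in>I. v (u i) = k} = (\<Union>j\<in>{j\<in>J. v j = k}. {i\<in>I. u i = j})" using uJ by auto
    also have "card \<dots> = (\<Sum>j\<in>{j\<in>J. v j = k}. card {i\<in>I. u i = j})"
      using assms by (intro card_UN_disjoint) auto
    also have "\<dots> = c' * c" using c c'[OF that] by simp
    finally show ?thesis .
  qed
  then show ?thesis using uJ vK by (auto simp: equifibred_def Pi_def)
qed

section \<open>Mixtures over a finite uniform index\<close>

text \<open>The index is discrete and finite, so joint measurability and integrability reduce to the
  sections \<open>h (i, _)\<close>; Fubini then leaves a finite average.\<close>

lemma integral_uniform_count_pair:
  fixes h :: "'i \<times> 'x \<Rightarrow> 'b::{banach, second_countable_topology}"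
  assumes I: "finite I" "I \<noteq> {}" and "prob_space M"
    and h: "\<And>i. i \<in> I \<Longrightarrow> integrable M (\<lambda>x. h (i, x))"
  shows "integrable (uniform_count_measure I \<Otimes>\<^sub>M M) h"
    and "(LINT z|(uniform_count_measure I \<Otimes>\<^sub>M M). h z) = average I (\<lambda>i. LINT x|M. h (i, x))"
proof -
  interpret U: prob_space "uniform_count_measure I" by (rule prob_space_uniform_count_measure) fact+
  interpret M: prob_space M by fact
  interpret P: pair_sigma_finite "uniform_count_measure I" M ..
  have "h \<in> borel_measurable (count_space I \<Otimes>\<^sub>M M)"
    using I h by (intro measurable_pair_measure_countable1) (auto intro: countable_finite)
  then have hm: "h \<in> borel_measurable (uniform_count_measure I \<Otimes>\<^sub>M M)"
    by (simp cong: measurable_cong_sets sets_pair_measure_cong add: sets_uniform_count_measure_count_space)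
  show int: "integrable (uniform_count_measure I \<Otimes>\<^sub>M M) h"
  proof (rule P.Fubini_integrable[OF hm])
    show "integrable (uniform_count_measure I) (\<lambda>i. LINT x|M. norm (h (i, x)))"
      unfolding uniform_count_measure_def using I by (intro integrable_point_measure_finite)
    show "AE i in uniform_count_measure I. integrable M (\<lambda>x. h (i, x))"
      using h by (intro AE_I2) (simp add: space_uniform_count_measure)
  qed
  have "(LINT z|(uniform_count_measure I \<Otimes>\<^sub>M M). h z)
      = (LINT i|uniform_count_measure I. LINT x|M. h (i, x))"
    using P.integral_fst'[OF int] by simp
  also have "\<dots> = average I (\<lambda>i. LINT x|M. h (i, x))"
    unfolding uniform_count_measure_def average_def using I
    by (subst lebesgue_integral_point_measure_finite) (auto simp: scaleR_sum_right divide_inverse)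
  finally show "(LINT z|(uniform_count_measure I \<Otimes>\<^sub>M M). h z) = average I (\<lambda>i. LINT x|M. h (i, x))" .
qed

lemma measurable_uniform_count_pair:
  assumes "finite I" "\<And>i. i \<in> I \<Longrightarrow> g i \<in> M \<rightarrow>\<^sub>M N"
  shows "(\<lambda>(i, x). g i x) \<in> uniform_count_measure I \<Otimes>\<^sub>M M \<rightarrow>\<^sub>M N"
proof -
  have "(\<lambda>(i, x). g i x) \<in> count_space I \<Otimes>\<^sub>M M \<rightarrow>\<^sub>M N"
    using assms by (intro measurable_pair_measure_countable1) (auto intro: countable_finite)
  then show ?thesis
    by (simp cong: measurable_cong_sets sets_pair_measure_cong add: sets_uniform_count_measure_count_space)
qed

lemma prob_space_uniform_count_pair:
  assumes "finite I" "I \<noteq> {}" "prob_space M"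
  shows "prob_space (uniform_count_measure I \<Otimes>\<^sub>M M)"
proof -
  interpret U: prob_space "uniform_count_measure I" by (rule prob_space_uniform_count_measure) fact+
  interpret M: prob_space M by fact
  interpret P: pair_prob_space "uniform_count_measure I" M ..
  show ?thesis by (rule P.prob_space_axioms)
qed

text \<open>The integral formula for mixtures, applied to an indicator function. Random images,
  symmetrizations and the coupling are all evaluated on sets in this form.\<close>

lemma measure_distr_uniform_count_pair:
  assumes I: "finite I" "I \<noteq> {}" and M: "prob_space M"
    and g: "\<And>i. i \<in> I \<Longrightarrow> g i \<in> M \<rightarrow>\<^sub>M N" and B: "B \<in> sets N"
  shows "measure (distr (uniform_count_measure I \<Otimes>\<^sub>M M) N (\<lambda>(i, x). g i x)) B
    = average I (\<lambda>i. measure (distr M N (g i)) B)"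
proof -
  interpret M: prob_space M by fact
  let ?G = "\<lambda>(i, x). g i x" and ?P = "uniform_count_measure I \<Otimes>\<^sub>M M"
  have G: "?G \<in> ?P \<rightarrow>\<^sub>M N" using I g by (intro measurable_uniform_count_pair) auto
  interpret P: prob_space ?P by (rule prob_space_uniform_count_pair) fact+
  have ind: "integrable M (\<lambda>x. indicator B (g i x) :: real)" if "i \<in> I" for i
    using g[OF that] B
    by (intro M.integrable_const_bound[where B=1]) (auto simp: indicator_def)
  have "measure (distr ?P N ?G) B = (LINT y|distr ?P N ?G. indicator B y)"
    using B by (simp add: Int_absorb2 sets.sets_into_space)
  also have "\<dots> = (LINT z|?P. indicator B (?G z))"
    using B G by (subst integral_distr) auto
  also have "\<dots> = average I (\<lambda>i. LINT x|M. indicator B (g i x))"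
    using integral_uniform_count_pair(2)[OF I M, of "\<lambda>z. indicator B (?G z) :: real"] ind by simp
  also have "\<dots> = average I (\<lambda>i. measure (distr M N (g i)) B)"
  proof (rule average_cong)
    fix i assume i: "i \<in> I"
    have "(LINT x|M. indicator B (g i x) :: real) = (LINT y|distr M N (g i). indicator B y)"
      using B g[OF i] by (subst integral_distr) auto
    also have "\<dots> = measure (distr M N (g i)) B"
      using B by (simp add: Int_absorb2 sets.sets_into_space)
    finally show "(LINT x|M. indicator B (g i x) :: real) = measure (distr M N (g i)) B" .
  qed
  finally show ?thesis .
qed

lemma prob_measure_eqI:
  assumes "prob_space M" "prob_space N" "sets M = sets N"
    and "\<And>B. B \<in> sets M \<Longrightarrow> measure M B = measure N B"
  shows "M = N"
proof -
  interpret M: prob_space M by fact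
  interpret N: prob_space N by fact
  show ?thesis using assms(3,4)
    by (intro measure_eqI) (auto simp: M.emeasure_eq_measure N.emeasure_eq_measure)
qed

section \<open>Random maps and permutations\<close>

declare One_nat_def [simp del]

lemma finite_fmaps [simp]: "finite (fmaps n m)"
  by (simp add: fmaps_def finite_PiE)

lemma fmaps_nonempty: "m > 0 \<Longrightarrow> fmaps n m \<noteq> {}"
  by (auto simp: fmaps_def PiE_eq_empty_iff)

lemma fmaps_app: "f \<in> fmaps n m \<Longrightarrow> i \<in> {1..n} \<Longrightarrow> f i \<in> {1..m}"
  unfolding fmaps_def by (rule PiE_mem)

lemma fmaps_eqI:
  "f \<in> fmaps n m \<Longrightarrow> g \<in> fmaps n m \<Longrightarrow> (\<And>i. i \<in> {1..n} \<Longrightarrow> f i = g i) \<Longrightarrow> f = g"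
  unfolding fmaps_def by (rule PiE_ext)

lemma compose_fmaps: "g \<in> fmaps n m \<Longrightarrow> f \<in> fmaps m k \<Longrightarrow> compose {1..n} f g \<in> fmaps n k"
  by (auto simp: fmaps_def compose_def PiE_iff Pi_iff)

lemma perms_fmaps: "\<sigma> \<in> perms n \<Longrightarrow> \<sigma> \<in> fmaps n n"
  by (simp add: perms_def)

lemma finite_perms [simp]: "finite (perms n)"
  by (simp add: perms_def)

lemma incl_perms: "incl n \<in> perms n"
  by (auto simp: perms_def fmaps_def incl_def bij_betw_def inj_on_def)

lemma perms_nonempty: "perms n \<noteq> {}"
  using incl_perms by blast

lemma incl_fmaps: "n \<le> N \<Longrightarrow> incl n \<in> fmaps n N"
  by (auto simp: fmaps_def incl_def)

lemma compose_perms: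
  assumes "\<sigma> \<in> perms n" "\<rho> \<in> perms n"
  shows "compose {1..n} \<sigma> \<rho> \<in> perms n"
proof -
  have "bij_betw \<sigma> {1..n} {1..n}" "bij_betw \<rho> {1..n} {1..n}"
    using assms by (auto simp: perms_def)
  then have "bij_betw (compose {1..n} \<sigma> \<rho>) {1..n} {1..n}" by (rule bij_betw_compose[rotated])
  then show ?thesis
    using compose_fmaps[OF perms_fmaps[OF assms(2)] perms_fmaps[OF assms(1)]] by (simp add: perms_def)
qed

lemma extend_to_perm:
  assumes T: "T \<subseteq> {1..n}" and g: "g \<in> T \<rightarrow> {1..n}" "inj_on g T"
  shows "\<exists>\<sigma>\<in>perms n. \<forall>i\<in>T. \<sigma> i = g i"
proof -
  have fin: "finite T" using T finite_subset by blast
  have "card ({1..n} - T) = card ({1..n} - g ` T)"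
    using T g fin by (subst (1 2) card_Diff_subset) (auto simp: card_image)
  then obtain h where h: "bij_betw h ({1..n} - T) ({1..n} - g ` T)"
    using finite_same_card_bij[of "{1..n} - T" "{1..n} - g ` T"] by auto
  define \<sigma> where "\<sigma> = (\<lambda>i\<in>{1..n}. if i \<in> T then g i else h i)"
  have "bij_betw (\<lambda>i. if i \<in> T then g i else h i) (T \<union> ({1..n} - T)) (g ` T \<union> ({1..n} - g ` T))"
    using g h by (intro bij_betw_disjoint_Un) (auto simp: bij_betw_def)
  moreover have "T \<union> ({1..n} - T) = {1..n}" "g ` T \<union> ({1..n} - g ` T) = {1..n}" using T g by auto
  ultimately have "bij_betw (\<lambda>i. if i \<in> T then g i else h i) {1..n} {1..n}" by metis
  moreover have "bij_betw \<sigma> {1..n} {1..n} \<longleftrightarrow> bij_betw (\<lambda>i. if i \<in> T then g i else h i) {1..n} {1..n}"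
    by (rule bij_betw_cong) (simp add: \<sigma>_def)
  ultimately have b: "bij_betw \<sigma> {1..n} {1..n}" by simp
  then have "\<sigma> \<in> perms n" by (auto simp: perms_def fmaps_def \<sigma>_def bij_betw_def PiE_iff)
  moreover have "\<forall>i\<in>T. \<sigma> i = g i" using T by (auto simp: \<sigma>_def)
  ultimately show ?thesis by blast
qed

section \<open>Composition and evaluation have fibres of constant size\<close>

text \<open>The fibre over \<open>g\<close> is the product over i of the fibres of \<open>u\<close>
  over \<open>g i\<close>, so its size is \<open>c ^ n\<close> whatever \<open>g\<close> is.\<close>

lemma equifibred_postcompose:
  assumes u: "equifibred u {1..M} {1..m}"
  shows "equifibred (compose {1..n} u) (fmaps n M) (fmaps n m)"
proof -
  obtain c where c: "\<And>j. j \<in> {1..m} \<Longrightarrow> card {x\<in>{1..M}. u x = j} = c" and um: "u \<in> {1..M} \<rightarrow> {1..m}"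
    using u unfolding equifibred_def by blast
  have "card {f \<in> fmaps n M. compose {1..n} u f = g} = c ^ n" if g: "g \<in> fmaps n m" for g
  proof -
    have "{f \<in> fmaps n M. compose {1..n} u f = g} = (\<Pi>\<^sub>E i\<in>{1..n}. {x\<in>{1..M}. u x = g i})"
    proof (intro set_eqI iffI)
      fix f assume "f \<in> (\<Pi>\<^sub>E i\<in>{1..n}. {x\<in>{1..M}. u x = g i})"
      then have f: "f \<in> fmaps n M" and fg: "\<And>i. i \<in> {1..n} \<Longrightarrow> u (f i) = g i"
        by (auto simp: fmaps_def PiE_iff)
      have "compose {1..n} u f = g"
        using g fg by (intro ext) (auto simp: compose_def fmaps_def PiE_iff extensional_def)
      with f show "f \<in> {f \<in> fmaps n M. compose {1..n} u f = g}" by simp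
    qed (auto simp: fmaps_def compose_def PiE_iff)
    also have "card \<dots> = c ^ n"
      using c fmaps_app[OF g] by (simp add: card_PiE)
    finally show ?thesis .
  qed
  moreover have "compose {1..n} u \<in> fmaps n M \<rightarrow> fmaps n m"
    using um by (auto simp: fmaps_def compose_def PiE_iff Pi_iff)
  ultimately show ?thesis unfolding equifibred_def by blast
qed

text \<open>A map in the fibre over \<open>g\<close> is prescribed on the image of
  \<open>\<theta>\<close> and free elsewhere. The size is left as a product of factors 1 and
  \<open>m\<close>: that it does not mention \<open>g\<close> is all that matters.\<close>

lemma equifibred_precompose:
  assumes \<theta>: "\<theta> \<in> fmaps n N" "inj_on \<theta> {1..n}"
  shows "equifibred (\<lambda>f. compose {1..n} f \<theta>) (fmaps N m) (fmaps n m)"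
proof -
  have "card {f \<in> fmaps N m. compose {1..n} f \<theta> = g} = (\<Prod>x=1..N. if x \<in> \<theta> ` {1..n} then 1 else m)"
    if g: "g \<in> fmaps n m" for g
  proof -
    let ?h = "inv_into {1..n} \<theta>"
    have "{f \<in> fmaps N m. compose {1..n} f \<theta> = g}
        = (\<Pi>\<^sub>E x\<in>{1..N}. if x \<in> \<theta> ` {1..n} then {g (?h x)} else {1..m})" (is "_ = ?P")
    proof (intro set_eqI iffI)
      fix f assume f: "f \<in> ?P"
      have fx: "f x \<in> (if x \<in> \<theta> ` {1..n} then {g (?h x)} else {1..m})" if "x \<in> {1..N}" for x
        using f that by (rule PiE_mem)
      have "f x \<in> {1..m}" if "x \<in> {1..N}" for x
      proof (cases "x \<in> \<theta> ` {1..n}")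
        case True
        then have "?h x \<in> {1..n}" by (rule inv_into_into)
        then show ?thesis using fx[OF that] True fmaps_app[OF g] by simp
      qed (use fx[OF that] in simp)
      then have "f \<in> fmaps N m" using f by (simp add: fmaps_def PiE_iff)
      moreover have "f (\<theta> i) = g i" if "i \<in> {1..n}" for i
        using fx[OF fmaps_app[OF \<theta>(1) that]] that \<theta>(2) by (simp add: inv_into_f_f)
      then have "compose {1..n} f \<theta> = g"
        using g by (intro ext) (auto simp: compose_def fmaps_def PiE_iff extensional_def)
      ultimately show "f \<in> {f \<in> fmaps N m. compose {1..n} f \<theta> = g}" by simp
    next
      fix f assume f: "f \<in> {f \<in> fmaps N m. compose {1..n} f \<theta> = g}"
      then have "f (\<theta> i) = g i" if "i \<in> {1..n}" for i
        using that by (auto simp: compose_def)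
      then show "f \<in> ?P" using f \<theta>(2) by (auto simp: fmaps_def PiE_iff inv_into_f_f)
    qed
    also have "card \<dots> = (\<Prod>x=1..N. if x \<in> \<theta> ` {1..n} then 1 else m)"
      by (subst card_PiE) (auto intro!: prod.cong)
    finally show ?thesis .
  qed
  moreover have "(\<lambda>f. compose {1..n} f \<theta>) \<in> fmaps N m \<rightarrow> fmaps n m"
    by (intro Pi_I) (rule compose_fmaps[OF \<theta>(1)])
  ultimately show ?thesis unfolding equifibred_def by blast
qed

text \<open>Pairwise independence of the values of a uniform map. The variance of a fibre size and
  the probability of a collision need nothing beyond this.\<close>

lemma equifibred_eval_pair:
  assumes "i \<in> {1..n}" "i' \<in> {1..n}" "i \<noteq> i'"
  shows "equifibred (\<lambda>f. (f i, f i')) (fmaps n m) ({1..m} \<times> {1..m})"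
proof -
  have "card {f \<in> fmaps n m. (f i, f i') = ab} = (\<Prod>x=1..n. if x \<in> {i, i'} then 1 else m)"
    if "ab \<in> {1..m} \<times> {1..m}" for ab
  proof -
    obtain a b where ab: "ab = (a, b)" "a \<in> {1..m}" "b \<in> {1..m}" using \<open>ab \<in> _\<close> by blast
    have "{f \<in> fmaps n m. (f i, f i') = ab}
        = (\<Pi>\<^sub>E x\<in>{1..n}. if x = i then {a} else if x = i' then {b} else {1..m})"
    proof (intro set_eqI iffI)
      fix f assume f: "f \<in> (\<Pi>\<^sub>E x\<in>{1..n}. if x = i then {a} else if x = i' then {b} else {1..m})"
      have "f x \<in> (if x = i then {a} else if x = i' then {b} else {1..m})" if "x \<in> {1..n}" for x
        using f that by (rule PiE_mem)
      then have "f i = a" "f i' = b" "\<And>x. x \<in> {1..n} \<Longrightarrow> f x \<in> {1..m}"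
        using assms ab by (fastforce split: if_splits)+
      then show "f \<in> {f \<in> fmaps n m. (f i, f i') = ab}"
        using f ab(1) by (simp add: fmaps_def PiE_iff)
    qed (use ab in \<open>simp add: fmaps_def PiE_iff\<close>)
    also have "card \<dots> = (\<Prod>x=1..n. if x \<in> {i, i'} then 1 else m)"
      by (subst card_PiE) (auto intro!: prod.cong)
    finally show ?thesis .
  qed
  moreover have "(\<lambda>f. (f i, f i')) \<in> fmaps n m \<rightarrow> {1..m} \<times> {1..m}"
    using assms by (auto simp: fmaps_def PiE_iff)
  ultimately show ?thesis unfolding equifibred_def by blast
qed

lemma equifibred_eval:
  assumes "i \<in> {1..n}"
  shows "equifibred (\<lambda>f. f i) (fmaps n m) {1..m}"
proof -
  have "card {f \<in> fmaps n m. f i = a} = (\<Prod>x=1..n. if x = i then 1 else m)"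
    if "a \<in> {1..m}" for a
  proof -
    have "{f \<in> fmaps n m. f i = a} = (\<Pi>\<^sub>E x\<in>{1..n}. if x = i then {a} else {1..m})"
    proof (intro set_eqI iffI)
      fix f assume f: "f \<in> (\<Pi>\<^sub>E x\<in>{1..n}. if x = i then {a} else {1..m})"
      have "f x \<in> (if x = i then {a} else {1..m})" if "x \<in> {1..n}" for x
        using f that by (rule PiE_mem)
      then have "f i = a" "\<And>x. x \<in> {1..n} \<Longrightarrow> f x \<in> {1..m}"
        using assms \<open>a \<in> _\<close> by (fastforce split: if_splits)+
      then show "f \<in> {f \<in> fmaps n m. f i = a}"
        using f by (simp add: fmaps_def PiE_iff)
    qed (use that in \<open>simp add: fmaps_def PiE_iff\<close>)
    also have "card \<dots> = (\<Prod>x=1..n. if x = i then 1 else m)"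
      by (subst card_PiE) (auto intro!: prod.cong)
    finally show ?thesis .
  qed
  moreover have "(\<lambda>f. f i) \<in> fmaps n m \<rightarrow> {1..m}"
    using assms by (auto simp: fmaps_def PiE_iff)
  ultimately show ?thesis unfolding equifibred_def by blast
qed

section \<open>Blocks of the equipartition and uniform permutations\<close>

text \<open>The fibre over \<open>j\<close> is the block of \<open>n div m\<close> consecutive
  numbers that ends at \<open>(n div m) * j\<close>.\<close>

lemma card_equipart_fibre:
  assumes "m > 0" "n > 0" "m dvd n" and j: "j \<in> {1..m}"
  shows "card {x\<in>{1..n}. equipart m n x = j} = n div m"
proof -
  define k where "k = n div m"
  have n: "n = m * k" using assms k_def by simp
  have k: "k > 0" using n \<open>n > 0\<close> by simp
  have jk: "k * j \<le> n" using j n by (simp add: mult.commute)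
  have "(x - 1) div k + 1 = j \<longleftrightarrow> x \<in> {k * (j - 1) + 1..k * j}" if "x \<ge> 1" for x
  proof -
    have "(x - 1) div k + 1 = j \<longleftrightarrow> (x - 1) div k = j - 1" using j by auto
    also have "\<dots> \<longleftrightarrow> k * (j - 1) \<le> x - 1 \<and> x - 1 < k * Suc (j - 1)"
      using k div_nat_eqI[of k "j - 1" "x - 1"] times_div_less_eq_dividend[of k "x - 1"]
        dividend_less_times_div[of k "x - 1"] by (metis mult_Suc_right)
    also have "\<dots> \<longleftrightarrow> x \<in> {k * (j - 1) + 1..k * j}" using j that by auto
    finally show ?thesis .
  qed
  then have "{x\<in>{1..n}. equipart m n x = j} = {k * (j - 1) + 1..k * j}"
    using jk by (auto simp: equipart_def k_def[symmetric])
  also have "card \<dots> = k" using j by (cases j) auto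
  finally show ?thesis by (simp add: k_def)
qed

lemma equipart_fmaps:
  assumes "m > 0" "n > 0" "m dvd n"
  shows "equipart m n \<in> fmaps n m"
proof -
  define k where "k = n div m"
  have n: "n = m * k" using assms k_def by simp
  have k: "k > 0" using n \<open>n > 0\<close> by simp
  have "(x - 1) div k + 1 \<le> m" if "x \<in> {1..n}" for x
  proof -
    have "x - 1 < m * k" using that n by auto
    then show ?thesis using div_less_iff_less_mult[OF k, of "x - 1" m] by linarith
  qed
  then show ?thesis by (auto simp: fmaps_def equipart_def k_def[symmetric])
qed

lemma equifibred_equipart:
  assumes "m > 0" "n > 0" "m dvd n"
  shows "equifibred (equipart m n) {1..n} {1..m}"
  using card_equipart_fibre[OF assms] fmaps_app[OF equipart_fmaps[OF assms]]
  by (auto simp: equifibred_def)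

lemma equifibred_perm: "\<sigma> \<in> perms n \<Longrightarrow> equifibred \<sigma> {1..n} {1..n}"
  by (auto simp: perms_def intro: bij_betw_equifibred)

text \<open>Right invariance of the uniform permutation: precomposition with \<open>\<rho>\<close>
  is injective because \<open>\<rho>\<close> is onto, and an injective self-map of a finite set is a
  bijection.\<close>

lemma equifibred_perms_precompose:
  assumes \<rho>: "\<rho> \<in> perms n"
  shows "equifibred (\<lambda>\<sigma>. compose {1..n} \<sigma> \<rho>) (perms n) (perms n)"
proof (rule bij_betw_equifibred)
  have "inj_on (\<lambda>\<sigma>. compose {1..n} \<sigma> \<rho>) (perms n)"
  proof (rule inj_onI)
    fix \<sigma> \<sigma>' assume s: "\<sigma> \<in> perms n" "\<sigma>' \<in> perms n" and eq: "compose {1..n} \<sigma> \<rho> = compose {1..n} \<sigma>' \<rho>"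
    show "\<sigma> = \<sigma>'"
    proof (rule fmaps_eqI[OF s[THEN perms_fmaps]])
      fix i assume "i \<in> {1..n}"
      then obtain j where "j \<in> {1..n}" "i = \<rho> j"
        using \<rho> unfolding perms_def bij_betw_def by blast
      then show "\<sigma> i = \<sigma>' i" using fun_cong[OF eq, of j] by (simp add: compose_eq)
    qed
  qed
  moreover have "(\<lambda>\<sigma>. compose {1..n} \<sigma> \<rho>) ` perms n \<subseteq> perms n"
    using compose_perms \<rho> by auto
  ultimately show "bij_betw (\<lambda>\<sigma>. compose {1..n} \<sigma> \<rho>) (perms n) (perms n)"
    by (simp add: bij_betw_def endo_inj_surj)
qed

text \<open>The image of a point under a uniform permutation is uniform. Some permutation takes
  \<open>i\<close> to any other point, so by right invariance the left side does not depend on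
  \<open>i\<close>; averaging it over all points and exchanging the averages leaves the mean of
  \<open>h\<close> for every single permutation. No permutations have to be counted.\<close>

lemma average_perms_eval:
  assumes i: "i \<in> {1..n}"
  shows "average (perms n) (\<lambda>\<sigma>. h (\<sigma> i)) = average {1..n} h"
proof -
  have eq: "average (perms n) (\<lambda>\<sigma>. h (\<sigma> i')) = average (perms n) (\<lambda>\<sigma>. h (\<sigma> i))" if "i' \<in> {1..n}" for i'
  proof -
    obtain \<rho> where \<rho>: "\<rho> \<in> perms n" "\<rho> i = i'"
      using extend_to_perm[of "{i}" n "\<lambda>_. i'"] i \<open>i' \<in> {1..n}\<close> by auto
    have "average (perms n) (\<lambda>\<sigma>. h (\<sigma> i))
        = average (perms n) (\<lambda>\<sigma>. h (compose {1..n} \<sigma> \<rho> i))"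
      using equifibred_average[OF _ _ perms_nonempty equifibred_perms_precompose[OF \<rho>(1)],
          of "\<lambda>\<sigma>. h (\<sigma> i)"] by simp
    then show ?thesis using i \<rho> by (simp add: compose_eq)
  qed
  have ne: "{1..n} \<noteq> {}" using i by blast
  have "average (perms n) (\<lambda>\<sigma>. h (\<sigma> i)) = average {1..n} (\<lambda>i'. average (perms n) (\<lambda>\<sigma>. h (\<sigma> i')))"
    using eq average_const[OF finite_atLeastAtMost ne] by (metis (no_types, lifting) average_cong)
  also have "\<dots> = average (perms n) (\<lambda>\<sigma>. average {1..n} (\<lambda>i'. h (\<sigma> i')))"
    by (rule average_swap)
  also have "\<dots> = average (perms n) (\<lambda>\<sigma>. average {1..n} h)"
    by (intro average_cong equifibred_average[OF _ _ ne] equifibred_perm) auto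
  also have "\<dots> = average {1..n} h"
    by (simp add: average_const perms_nonempty)
  finally show ?thesis .
qed

section \<open>Distance from a random map to an equipartition\<close>

text \<open>The permutation should send every point with value j into the block \<open>D j\<close>.
  The blocks have size n/m, so each fibre of \<open>f\<close> can be placed injectively except for
  its excess over n/m, and any completion to a permutation errs only at excess points. The absolute
  deviation bounds the excess and is what a variance controls.\<close>

lemma exists_close_equipart:
  assumes m: "m > 0" and n: "n > 0" and dvd: "m dvd n" and f: "f \<in> fmaps n m"
  shows "\<exists>\<sigma>\<in>perms n. real (card {i\<in>{1..n}. f i \<noteq> equipart m n (\<sigma> i)})
    \<le> (\<Sum>j=1..m. \<bar>real (card {i\<in>{1..n}. f i = j}) - real n / real m\<bar>)"
proof -
  define B where "B j = {i\<in>{1..n}. f i = j}" for j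
  define D where "D j = {x\<in>{1..n}. equipart m n x = j}" for j
  define k where "k = n div m"
  have nk: "real n / real m = real k" using dvd m by (simp add: k_def real_of_nat_div)
  have finB: "finite (B j)" and finD: "finite (D j)" for j by (simp_all add: B_def D_def)
  have cD: "card (D j) = k" if "j \<in> {1..m}" for j
    unfolding D_def k_def by (rule card_equipart_fibre[OF m n dvd that])
  have "\<exists>C h. C \<subseteq> B j \<and> card C = min (card (B j)) k \<and> inj_on h C \<and> h ` C \<subseteq> D j"
    if "j \<in> {1..m}" for j
  proof -
    \<comment> \<open>Keep as many points of the fibre as the block can hold.\<close>
    obtain C where C: "C \<subseteq> B j" "card C = min (card (B j)) k"
      by (rule obtain_subset_with_card_n[OF min.cobounded1])
    then have "card C \<le> card (D j)" using cD[OF that] by simp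
    then obtain h where "inj_on h C" "h ` C \<subseteq> D j"
      using card_le_inj[of C "D j"] finite_subset[OF C(1) finB] finD by blast
    with C show ?thesis by blast
  qed
  then obtain C h where C: "\<And>j. j \<in> {1..m} \<Longrightarrow> C j \<subseteq> B j"
    and cC: "\<And>j. j \<in> {1..m} \<Longrightarrow> card (C j) = min (card (B j)) k"
    and h: "\<And>j. j \<in> {1..m} \<Longrightarrow> inj_on (h j) (C j)"
    and hD: "\<And>j. j \<in> {1..m} \<Longrightarrow> h j ` C j \<subseteq> D j"
    by metis
  define T where "T = (\<Union>j\<in>{1..m}. C j)"
  define g where "g i = h (f i) i" for i
  have T: "f i \<in> {1..m} \<and> i \<in> C (f i)" if "i \<in> T" for i
  proof -
    obtain j where j: "j \<in> {1..m}" "i \<in> C j" using \<open>i \<in> T\<close> unfolding T_def by blast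
    then have "f i = j" using C[OF j(1)] by (auto simp: B_def)
    then show ?thesis using j by simp
  qed
  have gD: "g i \<in> D (f i)" if "i \<in> T" for i
    using hD[of "f i"] T[OF that] by (auto simp: g_def)
  have T_sub: "T \<subseteq> {1..n}"
  proof
    fix i assume "i \<in> T"
    then show "i \<in> {1..n}" using C[of "f i"] T[of i] by (auto simp: B_def)
  qed
  have "g \<in> T \<rightarrow> {1..n}" using gD by (auto simp: D_def)
  moreover have "inj_on g T"
  proof (rule inj_onI)
    fix i i' assume i: "i \<in> T" "i' \<in> T" and eq: "g i = g i'"
    \<comment> \<open>The blocks are disjoint, so \<open>g i\<close> determines \<open>f i\<close>;
      within one fibre \<open>h (f i)\<close> is injective.\<close>
    have "f i = f i'" using gD[OF i(1)] gD[OF i(2)] eq by (simp add: D_def)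
    then show "i = i'"
      using h[of "f i"] T[OF i(1)] T[OF i(2)] eq by (simp add: g_def inj_on_def)
  qed
  ultimately obtain \<sigma> where \<sigma>: "\<sigma> \<in> perms n" "\<And>i. i \<in> T \<Longrightarrow> \<sigma> i = g i"
    using extend_to_perm[OF T_sub] by blast
  have "{i\<in>{1..n}. f i \<noteq> equipart m n (\<sigma> i)} \<subseteq> (\<Union>j\<in>{1..m}. B j - C j)"
  proof
    fix i assume i: "i \<in> {i\<in>{1..n}. f i \<noteq> equipart m n (\<sigma> i)}"
    have "i \<notin> T"
    proof
      assume "i \<in> T"
      then have "\<sigma> i \<in> D (f i)" using \<sigma>(2) gD by metis
      then show False using i by (simp add: D_def)
    qed
    then show "i \<in> (\<Union>j\<in>{1..m}. B j - C j)"
      using i fmaps_app[OF f] by (auto simp: T_def B_def)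
  qed
  then have "card {i\<in>{1..n}. f i \<noteq> equipart m n (\<sigma> i)} \<le> card (\<Union>j\<in>{1..m}. B j - C j)"
    by (rule card_mono[rotated]) (use finB in auto)
  also have "\<dots> \<le> (\<Sum>j=1..m. card (B j - C j))" by (rule card_UN_le) simp
  finally have "real (card {i\<in>{1..n}. f i \<noteq> equipart m n (\<sigma> i)}) \<le> real (\<Sum>j=1..m. card (B j - C j))"
    by (rule of_nat_mono)
  also have "\<dots> = (\<Sum>j=1..m. real (card (B j - C j)))" by (rule of_nat_sum)
  also have "\<dots> \<le> (\<Sum>j=1..m. \<bar>real (card (B j)) - real k\<bar>)"
  proof (rule sum_mono)
    fix j assume j: "j \<in> {1..m}"
    have "card (B j - C j) = card (B j) - min (card (B j)) k"
      using C[OF j] cC[OF j] finite_subset[OF C[OF j] finB] by (simp add: card_Diff_subset)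
    then show "real (card (B j - C j)) \<le> \<bar>real (card (B j)) - real k\<bar>" by linarith
  qed
  finally show ?thesis using \<sigma>(1) unfolding nk B_def by (rule bexI)
qed

text \<open>The fibre size is binomial with n trials and success probability 1/m. Its mean absolute
  deviation is at most its standard deviation, the square root of n (1/m) (1 - 1/m).\<close>

lemma average_fibre_deviation:
  assumes m: "m > 0" and j: "j \<in> {1..m}"
  shows "average (fmaps n m) (\<lambda>f. \<bar>real (card {i\<in>{1..n}. f i = j}) - real n / real m\<bar>)
    \<le> sqrt (real n * (real m - 1)) / real m"
proof -
  \<comment> \<open>The centred indicator of the value \<open>j\<close>; the deviation is the sum of
    \<open>a (f i)\<close> over i.\<close>
  define a where "a x = of_bool (x = j) - 1 / real m" for x :: nat
  have sum_b: "(\<Sum>x=1..m. of_bool (x = j) :: real) = 1" using j by (simp add: of_bool_def)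
  have sum_a: "(\<Sum>x=1..m. a x) = 0" unfolding a_def sum_subtractf sum_b using m by simp
  have sum_a2: "(\<Sum>x=1..m. a x * a x) = (real m - 1) / real m"
  proof -
    have "(\<Sum>x=1..m. a x * a x) = (\<Sum>x=1..m. of_bool (x = j) * (1 - 2 / real m) + 1 / (real m)\<^sup>2)"
      by (rule sum.cong) (auto simp: a_def power2_eq_square field_simps)
    also have "\<dots> = 1 - 2 / real m + real m * (1 / (real m)\<^sup>2)"
      unfolding sum.distrib sum_distrib_right[symmetric] sum_b by simp
    also have "\<dots> = (real m - 1) / real m"
      using m by (simp add: power2_eq_square field_simps)
    finally show ?thesis .
  qed
  define X where "X f = real (card {i\<in>{1..n}. f i = j}) - real n / real m" for f :: "nat \<Rightarrow> nat"
  have X: "X f = (\<Sum>i=1..n. a (f i))" for f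
    by (simp add: X_def a_def sum_subtractf of_bool_def sum.If_cases Int_def)
  have fin: "finite (fmaps n m)" and ne: "fmaps n m \<noteq> {}" using m by (auto simp: fmaps_nonempty)
  have cov: "average (fmaps n m) (\<lambda>f. a (f i) * a (f i')) = (if i = i' then (real m - 1) / (real m)\<^sup>2 else 0)"
    if i: "i \<in> {1..n}" "i' \<in> {1..n}" for i i'
  proof (cases "i = i'")
    case True
    have "average (fmaps n m) (\<lambda>f. a (f i) * a (f i)) = average {1..m} (\<lambda>x. a x * a x)"
      using equifibred_average[OF fin _ ne equifibred_eval[OF i(1)], of "\<lambda>x. a x * a x"] by simp
    then show ?thesis using True sum_a2 by (simp add: average_def power2_eq_square divide_inverse)
  next
    case False
    have "average (fmaps n m) (\<lambda>f. a (f i) * a (f i')) = average ({1..m} \<times> {1..m}) (\<lambda>(x, y). a x * a y)"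
      using equifibred_average[OF fin _ ne equifibred_eval_pair[OF i False], of "\<lambda>(x, y). a x * a y"] by simp
    \<comment> \<open>The average over the square factors into two averages of \<open>a\<close>,
      each equal to 0.\<close>
    also have "\<dots> = 0"
      by (simp add: average_times) (simp add: average_def sum_distrib_left[symmetric] sum_a)
    finally show ?thesis using False by simp
  qed
  have "average (fmaps n m) (\<lambda>f. (X f)\<^sup>2)
      = (\<Sum>i=1..n. \<Sum>i'=1..n. average (fmaps n m) (\<lambda>f. a (f i) * a (f i')))"
  proof -
    have "average (fmaps n m) (\<lambda>f. (X f)\<^sup>2)
        = average (fmaps n m) (\<lambda>f. \<Sum>i=1..n. \<Sum>i'=1..n. a (f i) * a (f i'))"
      by (rule average_cong) (simp add: X power2_eq_square sum_product)
    also have "\<dots> = (\<Sum>i=1..n. \<Sum>i'=1..n. average (fmaps n m) (\<lambda>f. a (f i) * a (f i')))"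
      by (simp add: average_sum)
    finally show ?thesis .
  qed
  also have "\<dots> = (\<Sum>i=1..n. \<Sum>i'=1..n. if i = i' then (real m - 1) / (real m)\<^sup>2 else 0)"
    by (intro sum.cong refl cov)
  also have "\<dots> = real n * (real m - 1) / (real m)\<^sup>2" by simp
  finally have var: "average (fmaps n m) (\<lambda>f. (X f)\<^sup>2) = real n * (real m - 1) / (real m)\<^sup>2" .
  let ?Y = "average (fmaps n m) (\<lambda>f. \<bar>X f\<bar>)"
  have cF: "real (card (fmaps n m)) > 0" using fin ne by (simp add: card_gt_0_iff)
  \<comment> \<open>Cauchy-Schwarz against the constant function 1.\<close>
  have "(\<Sum>f\<in>fmaps n m. \<bar>X f\<bar>)\<^sup>2 \<le> (\<Sum>f\<in>fmaps n m. (X f)\<^sup>2) * real (card (fmaps n m))"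
    using sum_squared_le_sum_of_squares[of "\<lambda>f. \<bar>X f\<bar>" "fmaps n m"] fin by simp
  then have "?Y\<^sup>2 \<le> average (fmaps n m) (\<lambda>f. (X f)\<^sup>2)"
    using cF by (simp add: average_def power2_eq_square field_simps)
  then have "?Y \<le> sqrt (real n * (real m - 1) / (real m)\<^sup>2)"
    using var by (intro real_le_rsqrt) simp
  also have "\<dots> = sqrt (real n * (real m - 1)) / real m" by (simp add: real_sqrt_divide)
  finally show ?thesis by (simp add: X_def)
qed

text \<open>The m fibres contribute sqrt(n (m-1)) / m each. The permutation is chosen as a function
  of \<open>f\<close>, which is the form that the coupling uses.\<close>

lemma exists_close_equiparts:
  assumes m: "m > 0" and n: "n > 0" and dvd: "m dvd n"
  shows "\<exists>\<sigma>. (\<forall>f\<in>fmaps n m. \<sigma> f \<in> perms n) \<and>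
    average (fmaps n m) (\<lambda>f. real (card {i\<in>{1..n}. f i \<noteq> equipart m n (\<sigma> f i)}))
      \<le> sqrt (real n * (real m - 1))"
proof -
  let ?N = "\<lambda>f j. \<bar>real (card {i\<in>{1..n}. f i = j}) - real n / real m\<bar>"
  have "\<forall>f\<in>fmaps n m. \<exists>\<sigma>. \<sigma> \<in> perms n \<and>
      real (card {i\<in>{1..n}. f i \<noteq> equipart m n (\<sigma> i)}) \<le> (\<Sum>j=1..m. ?N f j)"
    using exists_close_equipart[OF m n dvd] by blast
  from bchoice[OF this] obtain \<sigma> where \<sigma>: "\<And>f. f \<in> fmaps n m \<Longrightarrow> \<sigma> f \<in> perms n"
    "\<And>f. f \<in> fmaps n m \<Longrightarrow> real (card {i\<in>{1..n}. f i \<noteq> equipart m n (\<sigma> f i)}) \<le> (\<Sum>j=1..m. ?N f j)"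
    by blast
  have "average (fmaps n m) (\<lambda>f. real (card {i\<in>{1..n}. f i \<noteq> equipart m n (\<sigma> f i)}))
      \<le> average (fmaps n m) (\<lambda>f. \<Sum>j=1..m. ?N f j)"
    using \<sigma>(2) by (rule average_mono)
  also have "\<dots> = (\<Sum>j=1..m. average (fmaps n m) (\<lambda>f. ?N f j))"
    by (rule average_sum)
  also have "\<dots> \<le> (\<Sum>j=1..m. sqrt (real n * (real m - 1)) / real m)"
    by (intro sum_mono average_fibre_deviation m)
  also have "\<dots> = sqrt (real n * (real m - 1))" using m by simp
  finally show ?thesis using \<sigma>(1) by blast
qed

section \<open>Collisions of a uniform self-map\<close>

text \<open>The birthday bound over ordered pairs of distinct points: each pair collides with
  probability 1/n, and a collision shows up in both orders. This accounts for the factor 2 on the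
  left and for the product d (d-1), without 1/2, on the right.\<close>

lemma average_not_inj:
  assumes n: "n > 0" and S: "S \<subseteq> {1..n}" "card S \<le> d"
  shows "2 * average (fmaps n n) (\<lambda>g. of_bool (\<not> inj_on g S)) \<le> real d * (real d - 1) / real n"
proof -
  define P where "P = {(i, j). i \<in> S \<and> j \<in> S \<and> i \<noteq> j}"
  have finS: "finite S" using S finite_subset by blast
  have Peq: "P = S \<times> S - (\<lambda>i. (i, i)) ` S" by (auto simp: P_def)
  have finP: "finite P" using finS by (simp add: Peq)
  have cP: "real (card P) = real (card S) * (real (card S) - 1)"
  proof -
    have "card P = card S * card S - card S"
      unfolding Peq using finS
      by (subst card_Diff_subset) (auto simp: card_cartesian_product card_image inj_on_def)
    then show ?thesis by (simp add: of_nat_diff algebra_simps)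
  qed
  have "2 * of_bool (\<not> inj_on g S) \<le> (\<Sum>(i, j)\<in>P. of_bool (g i = g j) :: real)" for g :: "nat \<Rightarrow> nat"
  proof (cases "inj_on g S")
    case False
    then obtain i j where ij: "i \<in> S" "j \<in> S" "i \<noteq> j" "g i = g j" by (auto simp: inj_on_def)
    have "(\<Sum>(i, j)\<in>{(i, j), (j, i)}. of_bool (g i = g j) :: real) \<le> (\<Sum>(i, j)\<in>P. of_bool (g i = g j))"
      using ij finP by (intro sum_mono2) (auto simp: P_def)
    then show ?thesis using ij False by simp
  qed (auto intro!: sum_nonneg)
  then have "average (fmaps n n) (\<lambda>g. 2 * of_bool (\<not> inj_on g S))
      \<le> average (fmaps n n) (\<lambda>g. \<Sum>(i, j)\<in>P. of_bool (g i = g j) :: real)"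
    by (intro average_mono)
  also have "\<dots> = (\<Sum>(i, j)\<in>P. average (fmaps n n) (\<lambda>g. of_bool (g i = g j)))"
    by (simp add: average_sum case_prod_unfold)
  also have "\<dots> = (\<Sum>(i, j)\<in>P. 1 / real n)"
  proof (rule sum.cong[OF refl], clarify)
    fix i j assume "(i, j) \<in> P"
    then have ij: "i \<in> {1..n}" "j \<in> {1..n}" "i \<noteq> j" using S by (auto simp: P_def)
    have "average (fmaps n n) (\<lambda>g. of_bool (g i = g j) :: real)
        = average ({1..n} \<times> {1..n}) (\<lambda>(x, y). of_bool (x = y))"
      using equifibred_average[OF _ _ fmaps_nonempty[OF n] equifibred_eval_pair[OF ij],
          of "\<lambda>(x, y). of_bool (x = y) :: real"] by simp
    also have "\<dots> = average {1..n} (\<lambda>x. 1 / real n)"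
      unfolding average_times by (rule average_cong) (simp add: average_def divide_inverse)
    also have "\<dots> = 1 / real n" using n by (intro average_const) auto
    finally show "average (fmaps n n) (\<lambda>g. of_bool (g i = g j)) = 1 / real n" .
  qed
  also have "\<dots> = real (card S) * (real (card S) - 1) / real n"
    by (simp add: cP case_prod_unfold)
  also have "\<dots> \<le> real d * (real d - 1) / real n"
  \<comment> \<open>Monotonicity of the product needs \<open>real (card S) - 1\<close> to be
    nonnegative, which fails for the empty set.\<close>
  proof (cases "card S = 0")
    case True
    have "0 \<le> real d * (real d - 1)" by (cases d) auto
    then show ?thesis using True by simp
  next
    case False
    then show ?thesis using S(2) by (intro divide_right_mono mult_mono) auto
  qed
  finally show ?thesis by (simp add: average_def sum_distrib_left[symmetric] mult_ac)
qed

section \<open>Coordinates and the norm\<close>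

text \<open>The basis need not be orthogonal. Let \<open>r\<close> be the component of
  \<open>b\<close> orthogonal to the span of the other basis vectors: pairing with \<open>r\<close>
  kills all of them, and dividing by \<open>r \<bullet> r\<close> normalizes the coefficient of
  \<open>b\<close>.\<close>

lemma dual_vector_exists:
  fixes B :: "'a::real_inner set"
  assumes B: "finite B" "independent B" and b: "b \<in> B"
  shows "\<exists>w. \<forall>x\<in>span B. representation B x b = x \<bullet> w"
proof -
  obtain C where C: "finite C" "span C = span (B - {b})" "pairwise orthogonal C"
    using basis_orthogonal[of "B - {b}"] B by auto
  \<comment> \<open>The orthogonal projection of \<open>b\<close> to the span of \<open>C\<close>.
    Should \<open>C\<close> contain 0, its term vanishes, as division by zero gives 0.\<close>
  define s where "s = (\<Sum>c\<in>C. (c \<bullet> b / (c \<bullet> c)) *\<^sub>R c)"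
  define r where "r = b - s"
  have s_span: "s \<in> span C" unfolding s_def by (intro span_sum span_scale span_base)
  have r_C: "c \<bullet> r = 0" if "c \<in> C" for c
  proof -
    have "c \<bullet> s = (\<Sum>c'\<in>C. (c' \<bullet> b / (c' \<bullet> c')) * (c \<bullet> c'))"
      unfolding s_def by (simp add: inner_sum_right)
    also have "\<dots> = (\<Sum>c'\<in>C. if c' = c then c \<bullet> b else 0)"
      using C(3) that by (intro sum.cong) (auto simp: pairwise_def orthogonal_def inner_commute)
    also have "\<dots> = c \<bullet> b" using C(1) that by simp
    finally show ?thesis by (simp add: r_def inner_diff_right)
  qed
  have r_span: "x \<bullet> r = 0" if "x \<in> span C" for x
    using that
  proof (induction rule: span_induct_alt)
    case (step c x y)
    then show ?case using r_C by (simp add: inner_add_left)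
  qed simp
  have "b \<notin> span (B - {b})" using B b by (auto simp: dependent_def)
  then have "r \<noteq> 0" using s_span C(2) by (auto simp: r_def)
  have br: "b \<bullet> r = r \<bullet> r"
    using r_span[OF s_span] by (simp add: r_def inner_diff_left)
  have "representation B x b = x \<bullet> (r /\<^sub>R (r \<bullet> r))" if x: "x \<in> span B" for x
  proof -
    have "x = (\<Sum>v\<in>B. representation B x v *\<^sub>R v)"
      using sum_representation_eq[OF B(2) x B(1) order_refl] by simp
    then have "x \<bullet> r = (\<Sum>v\<in>B. representation B x v * (v \<bullet> r))"
      by (metis (no_types, lifting) inner_sum_left inner_scaleR_left sum.cong)
    also have "\<dots> = (\<Sum>v\<in>B. if v = b then representation B x b * (r \<bullet> r) else 0)"
    proof (rule sum.cong[OF refl])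
      fix v assume "v \<in> B"
      show "representation B x v * (v \<bullet> r) = (if v = b then representation B x b * (r \<bullet> r) else 0)"
        using r_span[of v] \<open>v \<in> B\<close> br by (auto simp: C(2) span_base)
    qed
    also have "\<dots> = representation B x b * (r \<bullet> r)" using B b by simp
    finally show ?thesis using \<open>r \<noteq> 0\<close> by simp
  qed
  then show ?thesis by blast
qed

locale local_finset_rep = finset_rep V \<tau>
  for V :: "nat \<Rightarrow> 'a::{real_inner, banach, second_countable_topology} set"
    and \<tau> :: "nat \<Rightarrow> nat \<Rightarrow> (nat \<Rightarrow> nat) \<Rightarrow> 'a \<Rightarrow> 'a" +
  fixes A :: "nat \<Rightarrow> 'i set"
    and e :: "nat \<Rightarrow> 'i \<Rightarrow> 'a"
    and S :: "nat \<Rightarrow> 'i \<Rightarrow> nat set"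
    and d :: nat
  assumes basis: "n > 0 \<Longrightarrow> basis_of (A n) (e n) (V n)"
    and supp: "n > 0 \<Longrightarrow> \<alpha> \<in> A n \<Longrightarrow> S n \<alpha> \<subseteq> {1..n} \<and> card (S n \<alpha>) \<le> d"
    and local_dep: "n > 0 \<Longrightarrow> m > 0 \<Longrightarrow> f \<in> fmaps n m \<Longrightarrow> h \<in> fmaps n m \<Longrightarrow>
      \<alpha> \<in> A n \<Longrightarrow> (\<forall>i\<in>S n \<alpha>. f i = h i) \<Longrightarrow> \<tau> n m f (e n \<alpha>) = \<tau> n m h (e n \<alpha>)"
    and contr: "n > 0 \<Longrightarrow> m > 0 \<Longrightarrow> f \<in> fmaps n m \<Longrightarrow> \<alpha> \<in> A n \<Longrightarrow>
      l1_norm (A m) (e m) (\<tau> n m f (e n \<alpha>)) \<le> 1"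
begin

text \<open>The coordinate functionals are inner products with fixed vectors. They are thereby continuous on the
  whole ambient space, which gives the measurability of the \<open>\<ell>\<^sub>1\<close>-norm and of \<open>\<tau>\<close>.\<close>

definition dual :: "nat \<Rightarrow> 'i \<Rightarrow> 'a" where
  "dual n \<alpha> = (SOME w. \<forall>x\<in>V n. representation (e n ` A n) x (e n \<alpha>) = x \<bullet> w)"

abbreviation N1 :: "nat \<Rightarrow> 'a \<Rightarrow> real" where
  "N1 n \<equiv> l1_norm (A n) (e n)"

lemma subspace_V: "n > 0 \<Longrightarrow> subspace (V n)"
  using fin_dim by (metis subspace_span)

lemma e_V: "n > 0 \<Longrightarrow> \<alpha> \<in> A n \<Longrightarrow> e n \<alpha> \<in> V n"
  using basis[of n] by (auto simp: basis_of_def intro: span_base)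

lemma finite_A: 
  assumes "n > 0"
  shows "finite (A n)"
proof -
  obtain B where B: "finite B" "V n = span B" using fin_dim[OF assms] by blast
  have b: "inj_on (e n) (A n)" "independent (e n ` A n)" "span (e n ` A n) = V n"
    using basis[OF assms] by (auto simp: basis_of_def)
  have "e n ` A n \<subseteq> span B" using span_superset[of "e n ` A n"] b(3) B(2) by simp
  from independent_span_bound[OF B(1) b(2) this] have "finite (e n ` A n)" ..
  then show ?thesis using b(1) by (rule finite_imageD)
qed

lemma representation_dual:
  assumes "n > 0" "\<alpha> \<in> A n" "x \<in> V n"
  shows "representation (e n ` A n) x (e n \<alpha>) = x \<bullet> dual n \<alpha>"
proof -
  have b: "independent (e n ` A n)" "span (e n ` A n) = V n"
    using basis[OF assms(1)] by (auto simp: basis_of_def)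
  have "\<exists>w. \<forall>x\<in>V n. representation (e n ` A n) x (e n \<alpha>) = x \<bullet> w"
    using dual_vector_exists[of "e n ` A n" "e n \<alpha>"] b finite_A[OF assms(1)] assms(2) by auto
  from someI_ex[OF this] show ?thesis using assms(3) by (simp add: dual_def)
qed

lemma N1_eq: "n > 0 \<Longrightarrow> x \<in> V n \<Longrightarrow> N1 n x = (\<Sum>\<alpha>\<in>A n. \<bar>x \<bullet> dual n \<alpha>\<bar>)"
  unfolding l1_norm_def by (rule sum.cong) (simp_all add: representation_dual)

lemma expand:
  assumes "n > 0" "x \<in> V n"
  shows "(\<Sum>\<alpha>\<in>A n. (x \<bullet> dual n \<alpha>) *\<^sub>R e n \<alpha>) = x"
proof -
  have b: "inj_on (e n) (A n)" "independent (e n ` A n)" "span (e n ` A n) = V n"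
    using basis[OF assms(1)] by (auto simp: basis_of_def)
  have "x = (\<Sum>v\<in>e n ` A n. representation (e n ` A n) x v *\<^sub>R v)"
    by (rule sum_representation_eq[OF b(2) _ _ order_refl, symmetric])
      (use b(3) finite_A[OF assms(1)] assms(2) in auto)
  also have "\<dots> = (\<Sum>\<alpha>\<in>A n. representation (e n ` A n) x (e n \<alpha>) *\<^sub>R e n \<alpha>)"
    using b(1) by (subst sum.reindex) (auto simp: o_def)
  also have "\<dots> = (\<Sum>\<alpha>\<in>A n. (x \<bullet> dual n \<alpha>) *\<^sub>R e n \<alpha>)"
    using assms by (intro sum.cong) (simp_all add: representation_dual)
  finally show ?thesis by (rule sym)
qed

lemma tau_zero: "n > 0 \<Longrightarrow> m > 0 \<Longrightarrow> f \<in> fmaps n m \<Longrightarrow> \<tau> n m f 0 = 0"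
  using map_scaleR[of n m f 0 0] subspace_0[OF subspace_V, of n] by simp

lemma tau_sum:
  assumes nm: "n > 0" "m > 0" "f \<in> fmaps n m" and v: "\<And>i. i \<in> I \<Longrightarrow> v i \<in> V n"
  shows "\<tau> n m f (\<Sum>i\<in>I. c i *\<^sub>R v i) = (\<Sum>i\<in>I. c i *\<^sub>R \<tau> n m f (v i))"
  using v
proof (induction I rule: infinite_finite_induct)
  case (insert i I)
  have "(\<Sum>i\<in>I. c i *\<^sub>R v i) \<in> V n" "c i *\<^sub>R v i \<in> V n"
    using insert.prems subspace_V[OF nm(1)] by (auto intro!: subspace_sum subspace_scale)
  then show ?case using insert nm by (simp add: map_add map_scaleR)
qed (use tau_zero nm in auto)

text \<open>\<open>\<tau> n m f\<close> is constrained on \<open>V n\<close> only, while the right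
  side is linear and continuous on the whole carrier; measurability and integrals of
  \<open>\<tau>\<close> are obtained from it.\<close>

lemma tau_expand:
  assumes "n > 0" "m > 0" "f \<in> fmaps n m" "x \<in> V n"
  shows "\<tau> n m f x = (\<Sum>\<alpha>\<in>A n. (x \<bullet> dual n \<alpha>) *\<^sub>R \<tau> n m f (e n \<alpha>))"
  using tau_sum[OF assms(1-3), of "A n" "e n" "\<lambda>\<alpha>. x \<bullet> dual n \<alpha>"] e_V[OF assms(1)]
    expand[OF assms(1,4)] by simp

section \<open>Estimates in the norm\<close>

lemma N1_nonneg: "0 \<le> N1 n x"
  by (simp add: l1_norm_def sum_nonneg)

lemma N1_zero: "n > 0 \<Longrightarrow> N1 n 0 = 0"
  using N1_eq[of n 0] subspace_0[OF subspace_V, of n] by simp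

lemma N1_scaleR:
  assumes "n > 0" "x \<in> V n"
  shows "N1 n (c *\<^sub>R x) = \<bar>c\<bar> * N1 n x"
  using assms subspace_scale[OF subspace_V[OF assms(1)] assms(2), of c]
  by (simp add: N1_eq abs_mult sum_distrib_left)

lemma N1_add:
  assumes "n > 0" "x \<in> V n" "y \<in> V n"
  shows "N1 n (x + y) \<le> N1 n x + N1 n y"
  using assms subspace_add[OF subspace_V[OF assms(1)] assms(2,3)]
  by (simp add: N1_eq inner_add_left sum.distrib[symmetric] sum_mono abs_triangle_ineq)

lemma N1_diff:
  assumes "n > 0" "x \<in> V n" "y \<in> V n"
  shows "N1 n (x - y) \<le> N1 n x + N1 n y"
  using N1_add[OF assms(1,2), of "- y"] N1_scaleR[OF assms(1,3), of "-1"]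
    subspace_neg[OF subspace_V[OF assms(1)] assms(3)] by simp

lemma N1_sum:
  assumes n: "n > 0" and v: "\<And>i. i \<in> I \<Longrightarrow> v i \<in> V n"
  shows "N1 n (\<Sum>i\<in>I. v i) \<le> (\<Sum>i\<in>I. N1 n (v i))"
  using v
proof (induction I rule: infinite_finite_induct)
  case (insert i I)
  have "N1 n (v i + (\<Sum>i\<in>I. v i)) \<le> N1 n (v i) + N1 n (\<Sum>i\<in>I. v i)"
    using insert.prems n by (intro N1_add subspace_sum[OF subspace_V[OF n]]) auto
  then show ?case using insert by fastforce
qed (use N1_zero n in auto)

lemma average_V:
  assumes n: "n > 0" and v: "\<And>i. i \<in> I \<Longrightarrow> v i \<in> V n"
  shows "average I v \<in> V n"
  unfolding average_def using v by (intro subspace_scale subspace_sum subspace_V n)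

lemma N1_average:
  assumes n: "n > 0" and v: "\<And>i. i \<in> I \<Longrightarrow> v i \<in> V n"
  shows "N1 n (average I v) \<le> average I (\<lambda>i. N1 n (v i))"
proof -
  have "(\<Sum>i\<in>I. v i) \<in> V n" using v by (intro subspace_sum subspace_V n)
  then show ?thesis
    using mult_left_mono[OF N1_sum[of n I v, OF n v], of "inverse (real (card I))"]
    by (simp add: average_def N1_scaleR n)
qed

text \<open>The source of the factor 2 in the Wasserstein bound; in the bound for the means it is
  used up by the two orders of a colliding pair.\<close>

lemma N1_tau_diff_le_2:
  assumes "n > 0" "m > 0" "f \<in> fmaps n m" "h \<in> fmaps n m" "\<alpha> \<in> A n"
  shows "N1 m (\<tau> n m f (e n \<alpha>) - \<tau> n m h (e n \<alpha>)) \<le> 2"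
proof -
  have "N1 m (\<tau> n m f (e n \<alpha>) - \<tau> n m h (e n \<alpha>)) \<le> N1 m (\<tau> n m f (e n \<alpha>)) + N1 m (\<tau> n m h (e n \<alpha>))"
    using assms by (intro N1_diff maps_to[of n] e_V)
  then show ?thesis using contr[of n m f \<alpha>] contr[of n m h \<alpha>] assms by linarith
qed

text \<open>A union bound: the event that \<open>f\<close> and \<open>h\<close> differ somewhere on
  the support is replaced by the number of points where they do, which can be averaged one point at
  a time.\<close>

lemma N1_tau_diff_basis:
  assumes "n > 0" "m > 0" "f \<in> fmaps n m" "h \<in> fmaps n m" "\<alpha> \<in> A n"
  shows "N1 m (\<tau> n m f (e n \<alpha>) - \<tau> n m h (e n \<alpha>)) \<le> 2 * (\<Sum>i\<in>S n \<alpha>. of_bool (f i \<noteq> h i))"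
proof (cases "\<forall>i\<in>S n \<alpha>. f i = h i")
  case True
  then have "\<tau> n m f (e n \<alpha>) = \<tau> n m h (e n \<alpha>)" using assms by (intro local_dep)
  then show ?thesis using N1_zero[OF assms(2)] by (simp add: sum_nonneg)
next
  case False
  then obtain i where i: "i \<in> S n \<alpha>" "f i \<noteq> h i" by blast
  have "finite (S n \<alpha>)" using supp[OF assms(1,5)] finite_subset by blast
  then have "of_bool (f i \<noteq> h i) \<le> (\<Sum>i\<in>S n \<alpha>. of_bool (f i \<noteq> h i) :: real)"
    by (intro member_le_sum i(1)) auto
  then show ?thesis using i(2) N1_tau_diff_le_2[OF assms] by simp
qed

lemma N1_tau_diff:
  assumes "n > 0" "m > 0" "f \<in> fmaps n m" "h \<in> fmaps n m" "x \<in> V n"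
  shows "N1 m (\<tau> n m f x - \<tau> n m h x)
    \<le> (\<Sum>\<alpha>\<in>A n. \<bar>x \<bullet> dual n \<alpha>\<bar> * (2 * (\<Sum>i\<in>S n \<alpha>. of_bool (f i \<noteq> h i))))"
proof -
  let ?D = "\<lambda>\<alpha>. \<tau> n m f (e n \<alpha>) - \<tau> n m h (e n \<alpha>)"
  have D: "?D \<alpha> \<in> V m" if "\<alpha> \<in> A n" for \<alpha>
    using assms that by (intro subspace_diff subspace_V maps_to[of n] e_V)
  have "N1 m (\<tau> n m f x - \<tau> n m h x) = N1 m (\<Sum>\<alpha>\<in>A n. (x \<bullet> dual n \<alpha>) *\<^sub>R ?D \<alpha>)"
    using assms by (simp add: tau_expand[of n m _ x] sum_subtractf scaleR_diff_right)
  also have "\<dots> \<le> (\<Sum>\<alpha>\<in>A n. N1 m ((x \<bullet> dual n \<alpha>) *\<^sub>R ?D \<alpha>))"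
    using assms D by (intro N1_sum subspace_scale subspace_V)
  also have "\<dots> \<le> (\<Sum>\<alpha>\<in>A n. \<bar>x \<bullet> dual n \<alpha>\<bar> * (2 * (\<Sum>i\<in>S n \<alpha>. of_bool (f i \<noteq> h i))))"
    using assms D by (intro sum_mono) (simp add: N1_scaleR mult_left_mono N1_tau_diff_basis)
  finally show ?thesis .
qed

text \<open>A uniform map \<open>[n] \<rightarrow> [m]\<close> is \<open>equipart \<circ> p \<circ> g\<close> for a uniform permutation \<open>p\<close> and a uniform
  self-map \<open>g\<close>. When \<open>g\<close> is injective on the support of \<open>\<alpha>\<close>, it acts there like a permutation, which is
  absorbed by \<open>p\<close>; only the collisions of \<open>g\<close> on the support contribute.\<close>

lemma N1_average_equipart_diff:
  assumes n: "n > 0" and m: "m > 0" and dvd: "m dvd n" and \<alpha>: "\<alpha> \<in> A n"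
  shows "N1 m (average (perms n) (\<lambda>p. \<tau> n m (compose {1..n} (equipart m n) p) (e n \<alpha>))
      - average (fmaps n m) (\<lambda>f. \<tau> n m f (e n \<alpha>))) \<le> real d * (real d - 1) / real n"
proof -
  define y where "y f = \<tau> n m f (e n \<alpha>)" for f
  define c where "c p = compose {1..n} (equipart m n) p" for p
  have c: "c p \<in> fmaps n m" if "p \<in> fmaps n n" for p
    unfolding c_def by (rule compose_fmaps[OF that equipart_fmaps[OF m n dvd]])
  have yV: "y f \<in> V m" if "f \<in> fmaps n m" for f
    unfolding y_def using that n m \<alpha> by (intro maps_to e_V)
  have pg: "compose {1..n} p g \<in> fmaps n n" if "p \<in> perms n" "g \<in> fmaps n n" for p g
    using compose_fmaps[OF that(2) perms_fmaps[OF that(1)]] .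
  have cp: "c p \<in> fmaps n m" if "p \<in> perms n" for p
    using c perms_fmaps that by blast
  have cpg: "c (compose {1..n} p g) \<in> fmaps n m" if "p \<in> perms n" "g \<in> fmaps n n" for p g
    using c pg that by blast
  \<comment> \<open>The discrepancy caused by a fixed self-map \<open>g\<close>; its average over
    \<open>g\<close> is the difference to be bounded.\<close>
  define Z where "Z g = average (perms n) (\<lambda>p. y (c p)) - average (perms n) (\<lambda>p. y (c (compose {1..n} p g)))" for g
  have ZV: "Z g \<in> V m" if "g \<in> fmaps n n" for g
    unfolding Z_def using that by (intro subspace_diff subspace_V m average_V yV cp cpg)
  \<comment> \<open>The composite is uniform already for a fixed \<open>p\<close>. The average over
    \<open>p\<close> is added afterwards, to have a permutation that can absorb another.\<close>
  have F: "average (fmaps n m) y = average (fmaps n n) (\<lambda>g. y (c (compose {1..n} p g)))"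
    if "p \<in> perms n" for p
  proof -
    have "equifibred (\<lambda>g. c (compose {1..n} p g)) (fmaps n n) (fmaps n m)"
      unfolding c_def
      by (rule equifibred_comp[OF finite_fmaps finite_fmaps
            equifibred_postcompose[OF equifibred_perm[OF that]]
            equifibred_postcompose[OF equifibred_equipart[OF m n dvd]]])
    from equifibred_average[OF _ _ fmaps_nonempty[OF n] this, of y] show ?thesis by simp
  qed
  have "average (fmaps n m) y = average (perms n) (\<lambda>p. average (fmaps n m) y)"
    by (simp add: average_const perms_nonempty)
  also have "\<dots> = average (perms n) (\<lambda>p. average (fmaps n n) (\<lambda>g. y (c (compose {1..n} p g))))"
    by (rule average_cong) (rule F)
  also have "\<dots> = average (fmaps n n) (\<lambda>g. average (perms n) (\<lambda>p. y (c (compose {1..n} p g))))"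
    by (rule average_swap)
  finally have eq: "average (perms n) (\<lambda>p. y (c p)) - average (fmaps n m) y = average (fmaps n n) Z"
    unfolding Z_def average_diff by (simp add: average_const fmaps_nonempty n)
  have Z: "N1 m (Z g) \<le> 2 * of_bool (\<not> inj_on g (S n \<alpha>))" if g: "g \<in> fmaps n n" for g
  proof (cases "inj_on g (S n \<alpha>)")
    case True
    have S: "S n \<alpha> \<subseteq> {1..n}" using supp[OF n \<alpha>] by blast
    have "g \<in> S n \<alpha> \<rightarrow> {1..n}" using S fmaps_app[OF g] by blast
    then obtain q where q: "q \<in> perms n" "\<forall>i\<in>S n \<alpha>. q i = g i"
      using extend_to_perm[OF S _ True] by blast
    \<comment> \<open>Right invariance replaces p by p after q, and \<open>q\<close> may be
      exchanged for \<open>g\<close> because they agree on the support.\<close>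
    have "average (perms n) (\<lambda>p. y (c p)) = average (perms n) (\<lambda>p. y (c (compose {1..n} p q)))"
      using equifibred_average[OF finite_perms finite_perms perms_nonempty equifibred_perms_precompose[OF q(1)]]
      by (rule sym)
    also have "\<dots> = average (perms n) (\<lambda>p. y (c (compose {1..n} p g)))"
    proof (rule average_cong)
      fix p assume p: "p \<in> perms n"
      have "c (compose {1..n} p q) i = c (compose {1..n} p g) i" if "i \<in> S n \<alpha>" for i
        using that S q(2) by (auto simp: c_def compose_def)
      then show "y (c (compose {1..n} p q)) = y (c (compose {1..n} p g))"
        unfolding y_def using cpg[OF p perms_fmaps[OF q(1)]] cpg[OF p g]
        by (intro local_dep n m \<alpha>) auto
    qed
    finally show ?thesis using True N1_zero[OF m] by (simp add: Z_def)
  next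
    case False
    have "Z g = average (perms n) (\<lambda>p. y (c p) - y (c (compose {1..n} p g)))"
      unfolding Z_def by (rule average_diff[symmetric])
    also have "N1 m \<dots> \<le> average (perms n) (\<lambda>p. N1 m (y (c p) - y (c (compose {1..n} p g))))"
      using g by (intro N1_average m subspace_diff subspace_V yV cp cpg)
    also have "\<dots> \<le> average (perms n) (\<lambda>p. 2)"
      unfolding y_def using g by (intro average_mono N1_tau_diff_le_2 n m \<alpha> cp cpg)
    finally show ?thesis using False by (simp add: average_const perms_nonempty)
  qed
  have "N1 m (average (fmaps n n) Z) \<le> average (fmaps n n) (\<lambda>g. N1 m (Z g))"
    by (intro N1_average m ZV)
  also have "\<dots> \<le> average (fmaps n n) (\<lambda>g. 2 * of_bool (\<not> inj_on g (S n \<alpha>)))"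
    by (intro average_mono Z)
  also have "\<dots> = 2 * average (fmaps n n) (\<lambda>g. of_bool (\<not> inj_on g (S n \<alpha>)))"
    by (simp add: average_def sum_distrib_left[symmetric])
  also have "\<dots> \<le> real d * (real d - 1) / real n"
    using supp[OF n \<alpha>] by (intro average_not_inj n) auto
  finally show ?thesis unfolding eq[symmetric] y_def c_def .
qed

end

section \<open>Laws and limits\<close>

text \<open>\<open>\<Omega>\<close> is a parameter so that one development serves twice: with the
  given sets for the limits and density, and with \<open>V\<close> itself for the error bounds,
  which concern measures on the whole spaces.\<close>

locale local_finset_rep_on = local_finset_rep V \<tau> A e S d
  for V :: "nat \<Rightarrow> 'a::{real_inner, banach, second_countable_topology} set"
    and \<tau> and A :: "nat \<Rightarrow> 'i set" and e S d +
  fixes \<Omega> :: "nat \<Rightarrow> 'a set"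
  assumes Omega_V: "n > 0 \<Longrightarrow> \<Omega> n \<subseteq> V n"
    and Omega_maps: "n > 0 \<Longrightarrow> m > 0 \<Longrightarrow> f \<in> fmaps n m \<Longrightarrow> x \<in> \<Omega> n \<Longrightarrow> \<tau> n m f x \<in> \<Omega> m"
begin

section \<open>Laws of images, of uniform mixtures and of symmetrizations\<close>

lemma borel_probs_D:
  assumes "\<mu> \<in> borel_probs (\<Omega> n)"
  shows "prob_space \<mu>" "sets \<mu> = sets (borel_on (\<Omega> n))" "space \<mu> = \<Omega> n"
  using assms sets_eq_imp_space_eq[of \<mu> "borel_on (\<Omega> n)"]
  by (auto simp: borel_probs_def space_restrict_space)

lemma measurable_borel_probs:
  assumes "\<mu> \<in> borel_probs (\<Omega> n)" "g \<in> borel \<rightarrow>\<^sub>M N"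
  shows "g \<in> \<mu> \<rightarrow>\<^sub>M N"
  using measurable_restrict_space1[OF assms(2)] measurable_cong_sets[OF borel_probs_D(2)[OF assms(1)] refl]
  by blast

lemma tau_measurable:
  assumes \<mu>: "\<mu> \<in> borel_probs (\<Omega> n)" and nm: "n > 0" "m > 0" "f \<in> fmaps n m"
  shows "\<tau> n m f \<in> \<mu> \<rightarrow>\<^sub>M borel_on (\<Omega> m)"
proof (rule measurable_restrict_space2)
  have "(\<lambda>x. \<Sum>\<alpha>\<in>A n. (x \<bullet> dual n \<alpha>) *\<^sub>R \<tau> n m f (e n \<alpha>)) \<in> borel_measurable \<mu>"
    by (rule measurable_borel_probs[OF \<mu>]) measurable
  then show "\<tau> n m f \<in> borel_measurable \<mu>"
    using Omega_V[OF nm(1)] nm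
    by (subst measurable_cong[where g="\<lambda>x. \<Sum>\<alpha>\<in>A n. (x \<bullet> dual n \<alpha>) *\<^sub>R \<tau> n m f (e n \<alpha>)"])
      (auto simp: borel_probs_D(3)[OF \<mu>] intro!: tau_expand)
qed (use Omega_maps nm in \<open>auto simp: borel_probs_D(3)[OF \<mu>]\<close>)

lemma det_law_borel_probs:
  assumes "\<mu> \<in> borel_probs (\<Omega> n)" "n > 0" "m > 0" "f \<in> fmaps n m"
  shows "det_law \<tau> \<Omega> n m f \<mu> \<in> borel_probs (\<Omega> m)"
  using prob_space.prob_space_distr[OF borel_probs_D(1) tau_measurable, OF assms(1) assms]
  by (simp add: borel_probs_def det_law_def)

lemma measure_det_law:
  assumes "\<mu> \<in> borel_probs (\<Omega> n)" "n > 0" "m > 0" "f \<in> fmaps n m" "B \<in> sets (borel_on (\<Omega> m))"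
  shows "measure (det_law \<tau> \<Omega> n m f \<mu>) B = measure \<mu> (\<tau> n m f -` B \<inter> \<Omega> n)"
  using measure_distr[OF tau_measurable[OF assms(1-4)] assms(5)] borel_probs_D(3)[OF assms(1)]
  by (simp add: det_law_def)

lemma det_law_compose:
  assumes \<mu>: "\<mu> \<in> borel_probs (\<Omega> n)" and nmk: "n > 0" "m > 0" "k > 0"
    and g: "g \<in> fmaps n m" and f: "f \<in> fmaps m k"
  shows "det_law \<tau> \<Omega> n k (compose {1..n} f g) \<mu> = det_law \<tau> \<Omega> m k f (det_law \<tau> \<Omega> n m g \<mu>)"
proof -
  \<comment> \<open>\<open>tau_measurable\<close> speaks of members of \<open>borel_probs\<close>;
    the law of the inner image is one, with the sigma-algebra of
    \<open>borel_on (\<Omega> m)\<close>.\<close>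
  have "\<tau> m k f \<in> borel_on (\<Omega> m) \<rightarrow>\<^sub>M borel_on (\<Omega> k)"
    using tau_measurable[OF det_law_borel_probs[OF \<mu> nmk(1,2) g] nmk(2,3) f]
    by (simp add: det_law_def)
  then have "det_law \<tau> \<Omega> m k f (det_law \<tau> \<Omega> n m g \<mu>) = distr \<mu> (borel_on (\<Omega> k)) (\<tau> m k f \<circ> \<tau> n m g)"
    unfolding det_law_def by (rule distr_distr[OF _ tau_measurable[OF \<mu> nmk(1,2) g]])
  also have "\<dots> = det_law \<tau> \<Omega> n k (compose {1..n} f g) \<mu>"
    unfolding det_law_def using Omega_V[OF nmk(1)]
    by (intro distr_cong) (auto simp: borel_probs_D(3)[OF \<mu>] map_comp[OF nmk g f])
  finally show ?thesis ..
qed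

lemma borel_probs_eqI:
  assumes "\<mu> \<in> borel_probs (\<Omega> n)" "\<nu> \<in> borel_probs (\<Omega> n)"
    and "\<And>B. B \<in> sets (borel_on (\<Omega> n)) \<Longrightarrow> measure \<mu> B = measure \<nu> B"
  shows "\<mu> = \<nu>"
  using assms borel_probs_D[OF assms(1)] borel_probs_D[OF assms(2)]
  by (intro prob_measure_eqI) auto

lemma rand_law_borel_probs:
  assumes \<mu>: "\<mu> \<in> borel_probs (\<Omega> n)" and nm: "n > 0" "m > 0"
  shows "rand_law \<tau> \<Omega> n m \<mu> \<in> borel_probs (\<Omega> m)"
proof -
  have "prob_space (rand_law \<tau> \<Omega> n m \<mu>)"
    unfolding rand_law_def
    by (intro prob_space.prob_space_distr prob_space_uniform_count_pair measurable_uniform_count_pair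
        finite_fmaps fmaps_nonempty tau_measurable[OF \<mu>] borel_probs_D(1)[OF \<mu>] nm)
  then show ?thesis by (simp add: borel_probs_def rand_law_def)
qed

lemma measure_rand_law:
  assumes \<mu>: "\<mu> \<in> borel_probs (\<Omega> n)" and nm: "n > 0" "m > 0" and B: "B \<in> sets (borel_on (\<Omega> m))"
  shows "measure (rand_law \<tau> \<Omega> n m \<mu>) B
    = average (fmaps n m) (\<lambda>f. measure (det_law \<tau> \<Omega> n m f \<mu>) B)"
  unfolding rand_law_def det_law_def
  by (rule measure_distr_uniform_count_pair[OF finite_fmaps fmaps_nonempty[OF nm(2)]
        borel_probs_D(1)[OF \<mu>] tau_measurable[OF \<mu> nm] B])

text \<open>By functoriality the two operators act on \<open>\<Omega> n\<close> as the single
  injection \<open>compose {1..n} \<sigma> (incl n)\<close>, which makes a symmetrization a mixture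
  of \<open>det_law\<close>s.\<close>

lemma sym_step_measurable:
  assumes \<mu>: "\<mu> \<in> borel_probs (\<Omega> n)" and nN: "n > 0" "n \<le> N" and \<sigma>: "\<sigma> \<in> perms N"
  shows "(\<lambda>x. \<tau> N N \<sigma> (\<tau> n N (incl n) x)) \<in> \<mu> \<rightarrow>\<^sub>M borel_on (\<Omega> N)"
    and "distr \<mu> (borel_on (\<Omega> N)) (\<lambda>x. \<tau> N N \<sigma> (\<tau> n N (incl n) x))
      = det_law \<tau> \<Omega> n N (compose {1..n} \<sigma> (incl n)) \<mu>"
proof -
  have N: "N > 0" using nN by simp
  have \<iota>: "incl n \<in> fmaps n N" by (rule incl_fmaps[OF nN(2)])
  have eq: "\<tau> N N \<sigma> (\<tau> n N (incl n) x) = \<tau> n N (compose {1..n} \<sigma> (incl n)) x" if "x \<in> space \<mu>" for x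
    using map_comp[OF nN(1) N N \<iota> perms_fmaps[OF \<sigma>]] Omega_V[OF nN(1)] that
    by (auto simp: borel_probs_D(3)[OF \<mu>])
  have "\<tau> n N (compose {1..n} \<sigma> (incl n)) \<in> \<mu> \<rightarrow>\<^sub>M borel_on (\<Omega> N)"
    by (rule tau_measurable[OF \<mu> nN(1) N compose_fmaps[OF \<iota> perms_fmaps[OF \<sigma>]]])
  then show "(\<lambda>x. \<tau> N N \<sigma> (\<tau> n N (incl n) x)) \<in> \<mu> \<rightarrow>\<^sub>M borel_on (\<Omega> N)"
    using eq by (simp cong: measurable_cong)
  show "distr \<mu> (borel_on (\<Omega> N)) (\<lambda>x. \<tau> N N \<sigma> (\<tau> n N (incl n) x))
      = det_law \<tau> \<Omega> n N (compose {1..n} \<sigma> (incl n)) \<mu>"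
    unfolding det_law_def using eq by (intro distr_cong) auto
qed

lemma sym_law_borel_probs:
  assumes \<mu>: "\<mu> \<in> borel_probs (\<Omega> n)" and nN: "n > 0" "n \<le> N"
  shows "sym_law \<tau> \<Omega> n N \<mu> \<in> borel_probs (\<Omega> N)"
proof -
  have "prob_space (sym_law \<tau> \<Omega> n N \<mu>)"
    unfolding sym_law_def
    by (intro prob_space.prob_space_distr prob_space_uniform_count_pair measurable_uniform_count_pair
        finite_perms perms_nonempty sym_step_measurable[OF \<mu> nN] borel_probs_D(1)[OF \<mu>])
  then show ?thesis by (simp add: borel_probs_def sym_law_def)
qed

lemma measure_sym_law:
  assumes \<mu>: "\<mu> \<in> borel_probs (\<Omega> n)" and nN: "n > 0" "n \<le> N" and B: "B \<in> sets (borel_on (\<Omega> N))"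
  shows "measure (sym_law \<tau> \<Omega> n N \<mu>) B
    = average (perms N) (\<lambda>\<sigma>. measure (det_law \<tau> \<Omega> n N (compose {1..n} \<sigma> (incl n)) \<mu>) B)"
proof -
  have "measure (sym_law \<tau> \<Omega> n N \<mu>) B = average (perms N)
      (\<lambda>\<sigma>. measure (distr \<mu> (borel_on (\<Omega> N)) (\<lambda>x. \<tau> N N \<sigma> (\<tau> n N (incl n) x))) B)"
    unfolding sym_law_def
    by (rule measure_distr_uniform_count_pair[OF finite_perms perms_nonempty
          borel_probs_D(1)[OF \<mu>] sym_step_measurable(1)[OF \<mu> nN] B])
  then show ?thesis by (simp add: sym_step_measurable(2)[OF \<mu> nN] cong: average_cong)
qed

section \<open>Compatibility with projections and with symmetrization\<close>

text \<open>If F is uniform and \<open>u\<close> has fibres of equal size, then u after F is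
  uniform. With \<open>u\<close> an equipartition this is the compatibility required in the
  projective limit, with \<open>u\<close> a permutation it is the invariance of the law.\<close>

lemma det_law_rand_law:
  assumes \<mu>: "\<mu> \<in> borel_probs (\<Omega> n)" and n: "n > 0" and M: "M > 0" and m: "m > 0"
    and u: "u \<in> fmaps M m" "equifibred u {1..M} {1..m}"
  shows "det_law \<tau> \<Omega> M m u (rand_law \<tau> \<Omega> n M \<mu>) = rand_law \<tau> \<Omega> n m \<mu>"
proof (rule borel_probs_eqI)
  have R: "rand_law \<tau> \<Omega> n M \<mu> \<in> borel_probs (\<Omega> M)" by (rule rand_law_borel_probs[OF \<mu> n M])
  show "det_law \<tau> \<Omega> M m u (rand_law \<tau> \<Omega> n M \<mu>) \<in> borel_probs (\<Omega> m)"
    by (rule det_law_borel_probs[OF R M m u(1)])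
  show "rand_law \<tau> \<Omega> n m \<mu> \<in> borel_probs (\<Omega> m)" by (rule rand_law_borel_probs[OF \<mu> n m])
  fix B assume B: "B \<in> sets (borel_on (\<Omega> m))"
  let ?B = "\<tau> M m u -` B \<inter> \<Omega> M"
  have B': "?B \<in> sets (borel_on (\<Omega> M))"
    using measurable_sets[OF tau_measurable[OF R M m u(1)] B] borel_probs_D[OF R] by simp
  have "measure (det_law \<tau> \<Omega> M m u (rand_law \<tau> \<Omega> n M \<mu>)) B = measure (rand_law \<tau> \<Omega> n M \<mu>) ?B"
    by (rule measure_det_law[OF R M m u(1) B])
  also have "\<dots> = average (fmaps n M) (\<lambda>g. measure (det_law \<tau> \<Omega> n M g \<mu>) ?B)"
    by (rule measure_rand_law[OF \<mu> n M B'])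
  also have "\<dots> = average (fmaps n M) (\<lambda>g. measure (det_law \<tau> \<Omega> n m (compose {1..n} u g) \<mu>) B)"
  proof (rule average_cong)
    fix g assume g: "g \<in> fmaps n M"
    show "measure (det_law \<tau> \<Omega> n M g \<mu>) ?B = measure (det_law \<tau> \<Omega> n m (compose {1..n} u g) \<mu>) B"
      unfolding det_law_compose[OF \<mu> n M m g u(1)]
      by (rule measure_det_law[OF det_law_borel_probs[OF \<mu> n M g] M m u(1) B, symmetric])
  qed
  also have "\<dots> = average (fmaps n m) (\<lambda>f. measure (det_law \<tau> \<Omega> n m f \<mu>) B)"
    by (rule equifibred_average[OF finite_fmaps finite_fmaps fmaps_nonempty[OF M] equifibred_postcompose[OF u(2)]])
  also have "\<dots> = measure (rand_law \<tau> \<Omega> n m \<mu>) B"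
    by (rule measure_rand_law[OF \<mu> n m B, symmetric])
  finally show "measure (det_law \<tau> \<Omega> M m u (rand_law \<tau> \<Omega> n M \<mu>)) B = measure (rand_law \<tau> \<Omega> n m \<mu>) B" .
qed

text \<open>This makes the map well defined on classes. For each fixed permutation, \<sigma> after
  the inclusion is injective, and a uniform map precomposed with an injection is uniform.\<close>

lemma rand_law_sym_law:
  assumes \<mu>: "\<mu> \<in> borel_probs (\<Omega> n)" and n: "n > 0" and nN: "n \<le> N" and m: "m > 0"
  shows "rand_law \<tau> \<Omega> N m (sym_law \<tau> \<Omega> n N \<mu>) = rand_law \<tau> \<Omega> n m \<mu>"
proof (rule borel_probs_eqI)
  have N: "N > 0" using n nN by simp
  have \<iota>: "incl n \<in> fmaps n N" by (rule incl_fmaps[OF nN])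
  have R: "sym_law \<tau> \<Omega> n N \<mu> \<in> borel_probs (\<Omega> N)" by (rule sym_law_borel_probs[OF \<mu> n nN])
  show "rand_law \<tau> \<Omega> N m (sym_law \<tau> \<Omega> n N \<mu>) \<in> borel_probs (\<Omega> m)"
    by (rule rand_law_borel_probs[OF R N m])
  show "rand_law \<tau> \<Omega> n m \<mu> \<in> borel_probs (\<Omega> m)" by (rule rand_law_borel_probs[OF \<mu> n m])
  fix B assume B: "B \<in> sets (borel_on (\<Omega> m))"
  let ?c = "\<lambda>\<sigma>. compose {1..n} \<sigma> (incl n)"
  have c: "?c \<sigma> \<in> fmaps n N" "inj_on (?c \<sigma>) {1..n}" if \<sigma>: "\<sigma> \<in> perms N" for \<sigma>
  proof -
    show "?c \<sigma> \<in> fmaps n N" by (rule compose_fmaps[OF \<iota> perms_fmaps[OF \<sigma>]])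
    have "inj_on \<sigma> {1..N}" using \<sigma> by (simp add: perms_def bij_betw_def)
    then have "inj_on \<sigma> {1..n}" by (rule inj_on_subset) (use nN in auto)
    moreover have "?c \<sigma> i = \<sigma> i" if "i \<in> {1..n}" for i
      using that by (simp add: compose_def incl_def)
    ultimately show "inj_on (?c \<sigma>) {1..n}" using inj_on_cong[of "{1..n}" "?c \<sigma>" \<sigma>] by blast
  qed
  have "measure (rand_law \<tau> \<Omega> N m (sym_law \<tau> \<Omega> n N \<mu>)) B
      = average (fmaps N m) (\<lambda>f. measure (det_law \<tau> \<Omega> N m f (sym_law \<tau> \<Omega> n N \<mu>)) B)"
    by (rule measure_rand_law[OF R N m B])
  also have "\<dots> = average (fmaps N m) (\<lambda>f. average (perms N)
      (\<lambda>\<sigma>. measure (det_law \<tau> \<Omega> n m (compose {1..n} f (?c \<sigma>)) \<mu>) B))"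
  proof (rule average_cong)
    fix f assume f: "f \<in> fmaps N m"
    let ?B = "\<tau> N m f -` B \<inter> \<Omega> N"
    have B': "?B \<in> sets (borel_on (\<Omega> N))"
      using measurable_sets[OF tau_measurable[OF R N m f] B] borel_probs_D[OF R] by simp
    have "measure (det_law \<tau> \<Omega> N m f (sym_law \<tau> \<Omega> n N \<mu>)) B = measure (sym_law \<tau> \<Omega> n N \<mu>) ?B"
      by (rule measure_det_law[OF R N m f B])
    also have "\<dots> = average (perms N) (\<lambda>\<sigma>. measure (det_law \<tau> \<Omega> n N (?c \<sigma>) \<mu>) ?B)"
      by (rule measure_sym_law[OF \<mu> n nN B'])
    also have "\<dots> = average (perms N) (\<lambda>\<sigma>. measure (det_law \<tau> \<Omega> n m (compose {1..n} f (?c \<sigma>)) \<mu>) B)"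
    proof (rule average_cong)
      fix \<sigma> assume "\<sigma> \<in> perms N"
      note c = c[OF this]
      show "measure (det_law \<tau> \<Omega> n N (?c \<sigma>) \<mu>) ?B = measure (det_law \<tau> \<Omega> n m (compose {1..n} f (?c \<sigma>)) \<mu>) B"
        unfolding det_law_compose[OF \<mu> n N m c(1) f]
        by (rule measure_det_law[OF det_law_borel_probs[OF \<mu> n N c(1)] N m f B, symmetric])
    qed
    finally show "measure (det_law \<tau> \<Omega> N m f (sym_law \<tau> \<Omega> n N \<mu>)) B
      = average (perms N) (\<lambda>\<sigma>. measure (det_law \<tau> \<Omega> n m (compose {1..n} f (?c \<sigma>)) \<mu>) B)" .
  qed
  \<comment> \<open>The exchange holds \<sigma> fixed while f is averaged.\<close>
  also have "\<dots> = average (perms N) (\<lambda>\<sigma>. average (fmaps N m)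
      (\<lambda>f. measure (det_law \<tau> \<Omega> n m (compose {1..n} f (?c \<sigma>)) \<mu>) B))"
    by (rule average_swap)
  also have "\<dots> = average (perms N) (\<lambda>\<sigma>. measure (rand_law \<tau> \<Omega> n m \<mu>) B)"
  proof (rule average_cong)
    fix \<sigma> assume "\<sigma> \<in> perms N"
    note c = c[OF this]
    show "average (fmaps N m) (\<lambda>f. measure (det_law \<tau> \<Omega> n m (compose {1..n} f (?c \<sigma>)) \<mu>) B)
        = measure (rand_law \<tau> \<Omega> n m \<mu>) B"
      unfolding measure_rand_law[OF \<mu> n m B]
      by (rule equifibred_average[OF finite_fmaps finite_fmaps fmaps_nonempty[OF m] equifibred_precompose[OF c]])
  qed
  also have "\<dots> = measure (rand_law \<tau> \<Omega> n m \<mu>) B"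
    by (rule average_const[OF finite_perms perms_nonempty])
  finally show "measure (rand_law \<tau> \<Omega> N m (sym_law \<tau> \<Omega> n N \<mu>)) B = measure (rand_law \<tau> \<Omega> n m \<mu>) B" .
qed

section \<open>The map on the inductive limit\<close>

lemma inv_probs_D:
  assumes "\<mu> \<in> inv_probs \<tau> \<Omega> n"
  shows "\<mu> \<in> borel_probs (\<Omega> n)" "\<And>\<sigma>. \<sigma> \<in> perms n \<Longrightarrow> det_law \<tau> \<Omega> n n \<sigma> \<mu> = \<mu>"
  using assms by (auto simp: inv_probs_def det_law_def)

lemma rand_seq_proj_lim:
  assumes n: "n > 0" and \<mu>: "\<mu> \<in> inv_probs \<tau> \<Omega> n"
  shows "rand_seq \<tau> \<Omega> n \<mu> \<in> proj_lim \<tau> \<Omega>"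
proof -
  note b = inv_probs_D(1)[OF \<mu>]
  have inv: "rand_law \<tau> \<Omega> n m \<mu> \<in> inv_probs \<tau> \<Omega> m" if m: "m > 0" for m
  proof -
    have "det_law \<tau> \<Omega> m m \<sigma> (rand_law \<tau> \<Omega> n m \<mu>) = rand_law \<tau> \<Omega> n m \<mu>" if "\<sigma> \<in> perms m" for \<sigma>
      using that by (intro det_law_rand_law[OF b n m m] perms_fmaps equifibred_perm)
    then show ?thesis
      using rand_law_borel_probs[OF b n m] by (simp add: inv_probs_def det_law_def)
  qed
  have "det_law \<tau> \<Omega> M m (equipart m M) (rand_law \<tau> \<Omega> n M \<mu>) = rand_law \<tau> \<Omega> n m \<mu>"
    if "0 < m" "0 < M" "m dvd M" for m M
    using that by (intro det_law_rand_law[OF b n] equipart_fmaps equifibred_equipart)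
  with inv show ?thesis by (simp add: proj_lim_def rand_seq_def)
qed

lemma rand_seq_ind_step:
  assumes "ind_step \<tau> \<Omega> p q"
  shows "case_prod (rand_seq \<tau> \<Omega>) p = case_prod (rand_seq \<tau> \<Omega>) q"
proof -
  obtain n N \<mu> where *: "0 < n" "n \<le> N" "\<mu> \<in> inv_probs \<tau> \<Omega> n" "p = (n, \<mu>)" "q = (N, sym_law \<tau> \<Omega> n N \<mu>)"
    using assms unfolding ind_step_def by blast
  have "rand_law \<tau> \<Omega> N m (sym_law \<tau> \<Omega> n N \<mu>) = rand_law \<tau> \<Omega> n m \<mu>" if "m > 0" for m
    by (rule rand_law_sym_law[OF inv_probs_D(1)[OF *(3)] *(1,2) that])
  then show ?thesis by (auto simp: *(4,5) rand_seq_def)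
qed

text \<open>\<open>the_elem\<close> yields the intended value only if the image of the class is a
  singleton. So \<open>rand_seq\<close> must be constant along chains of generating steps traversed
  in either direction.\<close>

lemma lim_map_ind_class:
  assumes n: "n > 0" and \<mu>: "\<mu> \<in> inv_probs \<tau> \<Omega> n"
  shows "lim_map \<tau> \<Omega> (ind_class \<tau> \<Omega> n \<mu>) = rand_seq \<tau> \<Omega> n \<mu>"
proof -
  let ?r = "case_prod (rand_seq \<tau> \<Omega>)"
  have const: "?r q = ?r p" if "equivclp (ind_step \<tau> \<Omega>) p q" for p q
    using that
  proof (induction rule: equivclp_induct)
    case (step y z)
    from step.hyps(2) show ?case
    proof
      assume "ind_step \<tau> \<Omega> y z"
      from rand_seq_ind_step[OF this] step.IH show ?thesis by (rule trans[OF sym])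
    next
      assume "ind_step \<tau> \<Omega> z y"
      from rand_seq_ind_step[OF this] step.IH show ?thesis by (rule trans)
    qed
  qed simp
  have "(n, \<mu>) \<in> ind_class \<tau> \<Omega> n \<mu>"
    using n \<mu> by (simp add: ind_class_def ind_rel_def ind_union_def)
  moreover have "?r q = rand_seq \<tau> \<Omega> n \<mu>" if "q \<in> ind_class \<tau> \<Omega> n \<mu>" for q
    using const[of "(n, \<mu>)" q] that by (auto simp: ind_class_def ind_rel_def)
  ultimately have "?r ` ind_class \<tau> \<Omega> n \<mu> = {rand_seq \<tau> \<Omega> n \<mu>}"
    by (intro equalityI image_subsetI) (auto intro!: rev_image_eqI)
  then show ?thesis by (simp add: lim_map_def)
qed

lemma ind_lim_eq: "ind_lim \<tau> \<Omega> = {ind_class \<tau> \<Omega> n \<mu> | n \<mu>. n > 0 \<and> \<mu> \<in> inv_probs \<tau> \<Omega> n}"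
  by (auto simp: ind_lim_def ind_class_def quotient_def ind_union_def)

lemma lim_map_proj_lim: "lim_map \<tau> \<Omega> \<in> ind_lim \<tau> \<Omega> \<rightarrow> proj_lim \<tau> \<Omega>"
  using rand_seq_proj_lim lim_map_ind_class by (auto simp: ind_lim_eq)

lemma rand_seq_in_image:
  "n > 0 \<Longrightarrow> \<mu> \<in> inv_probs \<tau> \<Omega> n \<Longrightarrow> rand_seq \<tau> \<Omega> n \<mu> \<in> lim_map \<tau> \<Omega> ` ind_lim \<tau> \<Omega>"
  using lim_map_ind_class[of n \<mu>] by (intro image_eqI[of _ _ "ind_class \<tau> \<Omega> n \<mu>"]) (auto simp: ind_lim_eq)

section \<open>Error bounds\<close>

lemma N1_measurable:
  assumes "\<mu> \<in> borel_probs (\<Omega> n)" "n > 0"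
  shows "N1 n \<in> borel_measurable \<mu>"
proof -
  have "(\<lambda>x. \<Sum>\<alpha>\<in>A n. \<bar>x \<bullet> dual n \<alpha>\<bar>) \<in> borel_measurable \<mu>"
    by (rule measurable_borel_probs[OF assms(1)]) measurable
  then show ?thesis
    using Omega_V[OF assms(2)] assms(2)
    by (subst measurable_cong[where g="\<lambda>x. \<Sum>\<alpha>\<in>A n. \<bar>x \<bullet> dual n \<alpha>\<bar>"])
      (auto simp: borel_probs_D(3)[OF assms(1)] intro!: N1_eq)
qed

lemma integrable_coord:
  assumes \<mu>: "\<mu> \<in> borel_probs (\<Omega> n)" and n: "n > 0" and int: "integrable \<mu> (N1 n)" and \<alpha>: "\<alpha> \<in> A n"
  shows "integrable \<mu> (\<lambda>x. x \<bullet> dual n \<alpha>)"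
proof (rule Bochner_Integration.integrable_bound[OF int])
  show "(\<lambda>x. x \<bullet> dual n \<alpha>) \<in> borel_measurable \<mu>"
    by (rule measurable_borel_probs[OF \<mu>]) measurable
  have "\<bar>x \<bullet> dual n \<alpha>\<bar> \<le> N1 n x" if "x \<in> \<Omega> n" for x
    using that Omega_V[OF n] finite_A[OF n] \<alpha> n
    by (subst N1_eq) (auto intro!: member_le_sum)
  then show "AE x in \<mu>. norm (x \<bullet> dual n \<alpha>) \<le> norm (N1 n x)"
    by (intro AE_I2) (simp add: borel_probs_D(3)[OF \<mu>] N1_nonneg)
qed

lemma integral_N1:
  assumes \<mu>: "\<mu> \<in> borel_probs (\<Omega> n)" and n: "n > 0" and int: "integrable \<mu> (N1 n)"
  shows "(LINT x|\<mu>. N1 n x) = (\<Sum>\<alpha>\<in>A n. LINT x|\<mu>. \<bar>x \<bullet> dual n \<alpha>\<bar>)"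
proof -
  have "(LINT x|\<mu>. N1 n x) = (LINT x|\<mu>. (\<Sum>\<alpha>\<in>A n. \<bar>x \<bullet> dual n \<alpha>\<bar>))"
    using Omega_V[OF n] n
    by (intro Bochner_Integration.integral_cong) (auto simp: borel_probs_D(3)[OF \<mu>] intro!: N1_eq)
  also have "\<dots> = (\<Sum>\<alpha>\<in>A n. LINT x|\<mu>. \<bar>x \<bullet> dual n \<alpha>\<bar>)"
    by (intro Bochner_Integration.integral_sum integrable_abs integrable_coord[OF \<mu> n int])
  finally show ?thesis .
qed

text \<open>The mean of the image depends on \<open>\<mu>\<close> only through the means of the
  coordinates, which are the same for all \<open>f\<close>.\<close>

lemma tau_integral:
  assumes \<mu>: "\<mu> \<in> borel_probs (\<Omega> n)" and n: "n > 0" and m: "m > 0" and f: "f \<in> fmaps n m"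
    and int: "integrable \<mu> (N1 n)"
  shows "integrable \<mu> (\<tau> n m f)"
    and "(LINT x|\<mu>. \<tau> n m f x) = (\<Sum>\<alpha>\<in>A n. (LINT x|\<mu>. x \<bullet> dual n \<alpha>) *\<^sub>R \<tau> n m f (e n \<alpha>))"
proof -
  let ?T = "\<lambda>x. \<Sum>\<alpha>\<in>A n. (x \<bullet> dual n \<alpha>) *\<^sub>R \<tau> n m f (e n \<alpha>)"
  have eq: "\<tau> n m f x = ?T x" if "x \<in> space \<mu>" for x
    using that Omega_V[OF n] by (intro tau_expand n m f) (auto simp: borel_probs_D(3)[OF \<mu>])
  have i: "integrable \<mu> (\<lambda>x. (x \<bullet> dual n \<alpha>) *\<^sub>R \<tau> n m f (e n \<alpha>))" if "\<alpha> \<in> A n" for \<alpha>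
    by (intro integrable_scaleR_left integrable_coord[OF \<mu> n int that])
  have "integrable \<mu> ?T" by (intro Bochner_Integration.integrable_sum i)
  then show "integrable \<mu> (\<tau> n m f)"
    by (subst Bochner_Integration.integrable_cong[OF refl eq])
  have "(LINT x|\<mu>. \<tau> n m f x) = (LINT x|\<mu>. ?T x)"
    by (intro Bochner_Integration.integral_cong refl eq)
  also have "\<dots> = (\<Sum>\<alpha>\<in>A n. LINT x|\<mu>. (x \<bullet> dual n \<alpha>) *\<^sub>R \<tau> n m f (e n \<alpha>))"
    by (rule Bochner_Integration.integral_sum) (rule i)
  also have "\<dots> = (\<Sum>\<alpha>\<in>A n. (LINT x|\<mu>. x \<bullet> dual n \<alpha>) *\<^sub>R \<tau> n m f (e n \<alpha>))"
    by (intro sum.cong refl integral_scaleR_left integrable_coord[OF \<mu> n int])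
  finally show "(LINT x|\<mu>. \<tau> n m f x) = (\<Sum>\<alpha>\<in>A n. (LINT x|\<mu>. x \<bullet> dual n \<alpha>) *\<^sub>R \<tau> n m f (e n \<alpha>))" .
qed

text \<open>Invariance of \<open>\<mu>\<close> lets \<open>equipart\<close> be averaged over
  precomposition with all permutations without changing the mean. Both means are then combinations
  over the basis with the same coefficients, so \<open>N1_average_equipart_diff\<close> applies to
  each basis vector, and the absolute coefficients add up to at most the mean norm.\<close>

lemma expectation_bound:
  assumes n: "n > 0" and m: "m > 0" and dvd: "m dvd n" and \<mu>: "\<mu> \<in> inv_probs \<tau> \<Omega> n"
    and int: "integrable \<mu> (N1 n)"
  shows "N1 m ((LINT x|\<mu>. \<tau> n m (equipart m n) x)
      - (LINT (f, x)|(uniform_count_measure (fmaps n m) \<Otimes>\<^sub>M \<mu>). \<tau> n m f x))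
    \<le> real d * (real d - 1) / real n * (LINT x|\<mu>. N1 n x)"
proof -
  note b = inv_probs_D(1)[OF \<mu>]
  let ?q = "equipart m n" and ?K = "real d * (real d - 1) / real n"
  have q: "?q \<in> fmaps n m" by (rule equipart_fmaps[OF m n dvd])
  define c where "c \<alpha> = (LINT x|\<mu>. x \<bullet> dual n \<alpha>)" for \<alpha>
  define D1 where "D1 \<alpha> = average (perms n) (\<lambda>p. \<tau> n m (compose {1..n} ?q p) (e n \<alpha>))" for \<alpha>
  define D2 where "D2 \<alpha> = average (fmaps n m) (\<lambda>f. \<tau> n m f (e n \<alpha>))" for \<alpha>
  have V: "\<tau> n m f (e n \<alpha>) \<in> V m" if "f \<in> fmaps n m" "\<alpha> \<in> A n" for f \<alpha>
    using that n m by (intro maps_to e_V)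
  have DV: "D1 \<alpha> - D2 \<alpha> \<in> V m" if "\<alpha> \<in> A n" for \<alpha>
    unfolding D1_def D2_def using that
    by (intro subspace_diff subspace_V m average_V V compose_fmaps[OF perms_fmaps q])
  have avg: "average I (\<lambda>i. \<Sum>\<alpha>\<in>A n. c \<alpha> *\<^sub>R v i \<alpha>) = (\<Sum>\<alpha>\<in>A n. c \<alpha> *\<^sub>R average I (\<lambda>i. v i \<alpha>))"
    for I :: "(nat \<Rightarrow> nat) set" and v :: "(nat \<Rightarrow> nat) \<Rightarrow> 'i \<Rightarrow> 'a"
    unfolding average_sum by (simp add: average_def scaleR_sum_right mult.commute)
  have "(LINT x|\<mu>. \<tau> n m ?q x) = (\<Sum>\<alpha>\<in>A n. c \<alpha> *\<^sub>R \<tau> n m (compose {1..n} ?q p) (e n \<alpha>))"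
    if p: "p \<in> perms n" for p
  proof -
    note pf = perms_fmaps[OF p]
    have "(LINT x|\<mu>. \<tau> n m ?q x) = (LINT x|det_law \<tau> \<Omega> n n p \<mu>. \<tau> n m ?q x)"
      by (simp only: inv_probs_D(2)[OF \<mu> p])
    also have "\<dots> = (LINT x|\<mu>. \<tau> n m ?q (\<tau> n n p x))"
      unfolding det_law_def
    proof (rule integral_distr[OF tau_measurable[OF b n n pf]])
      show "\<tau> n m ?q \<in> borel_measurable (borel_on (\<Omega> n))"
        using borel_measurable_integrable[OF tau_integral(1)[OF b n m q int]]
          measurable_cong_sets[OF borel_probs_D(2)[OF b] refl] by blast
    qed
    also have "\<dots> = (LINT x|\<mu>. \<tau> n m (compose {1..n} ?q p) x)"
      using Omega_V[OF n]
      by (intro Bochner_Integration.integral_cong refl map_comp[OF n n m pf q, symmetric])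
        (auto simp: borel_probs_D(3)[OF b])
    also have "\<dots> = (\<Sum>\<alpha>\<in>A n. c \<alpha> *\<^sub>R \<tau> n m (compose {1..n} ?q p) (e n \<alpha>))"
      unfolding c_def by (rule tau_integral(2)[OF b n m compose_fmaps[OF pf q] int])
    finally show ?thesis .
  qed
  then have "average (perms n) (\<lambda>p. LINT x|\<mu>. \<tau> n m ?q x)
      = average (perms n) (\<lambda>p. \<Sum>\<alpha>\<in>A n. c \<alpha> *\<^sub>R \<tau> n m (compose {1..n} ?q p) (e n \<alpha>))"
    by (rule average_cong)
  then have 1: "(LINT x|\<mu>. \<tau> n m ?q x) = (\<Sum>\<alpha>\<in>A n. c \<alpha> *\<^sub>R D1 \<alpha>)"
    unfolding average_const[OF finite_perms perms_nonempty] avg D1_def .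
  have "(LINT (f, x)|(uniform_count_measure (fmaps n m) \<Otimes>\<^sub>M \<mu>). \<tau> n m f x)
      = average (fmaps n m) (\<lambda>f. LINT x|\<mu>. (case (f, x) of (f, x) \<Rightarrow> \<tau> n m f x))"
    by (rule integral_uniform_count_pair(2)[OF finite_fmaps fmaps_nonempty[OF m] borel_probs_D(1)[OF b]])
      (simp add: tau_integral(1)[OF b n m _ int])
  also have "\<dots> = average (fmaps n m) (\<lambda>f. \<Sum>\<alpha>\<in>A n. c \<alpha> *\<^sub>R \<tau> n m f (e n \<alpha>))"
    unfolding c_def by (rule average_cong) (simp add: tau_integral(2)[OF b n m _ int])
  finally have 2: "(LINT (f, x)|(uniform_count_measure (fmaps n m) \<Otimes>\<^sub>M \<mu>). \<tau> n m f x)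
      = (\<Sum>\<alpha>\<in>A n. c \<alpha> *\<^sub>R D2 \<alpha>)"
    unfolding avg D2_def .
  have "N1 m ((\<Sum>\<alpha>\<in>A n. c \<alpha> *\<^sub>R D1 \<alpha>) - (\<Sum>\<alpha>\<in>A n. c \<alpha> *\<^sub>R D2 \<alpha>)) = N1 m (\<Sum>\<alpha>\<in>A n. c \<alpha> *\<^sub>R (D1 \<alpha> - D2 \<alpha>))"
    by (simp add: sum_subtractf scaleR_diff_right)
  also have "\<dots> \<le> (\<Sum>\<alpha>\<in>A n. N1 m (c \<alpha> *\<^sub>R (D1 \<alpha> - D2 \<alpha>)))"
    by (intro N1_sum m subspace_scale subspace_V DV)
  also have "\<dots> = (\<Sum>\<alpha>\<in>A n. \<bar>c \<alpha>\<bar> * N1 m (D1 \<alpha> - D2 \<alpha>))"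
    by (intro sum.cong refl N1_scaleR m DV)
  also have "\<dots> \<le> (\<Sum>\<alpha>\<in>A n. (LINT x|\<mu>. \<bar>x \<bullet> dual n \<alpha>\<bar>) * ?K)"
    unfolding c_def D1_def D2_def
    by (intro sum_mono mult_mono N1_average_equipart_diff n m dvd integral_abs_bound N1_nonneg
        Bochner_Integration.integral_nonneg) auto
  also have "\<dots> = ?K * (LINT x|\<mu>. N1 n x)"
    by (simp add: integral_N1[OF b n int] sum_distrib_left mult.commute)
  finally show ?thesis unfolding 1 2 .
qed

section \<open>The Wasserstein bound\<close>

text \<open>At a fixed point i the value of p is uniform on [n], so a mismatch at i is as likely as
  one at a uniform point: the mean number of mismatches divided by n. At most \<open>d\<close>
  points are summed.\<close>

lemma average_mismatch:
  assumes S: "S' \<subseteq> {1..n}" "card S' \<le> d"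
  shows "average (fmaps n m \<times> perms n)
      (\<lambda>(f, p). \<Sum>i\<in>S'. of_bool (compose {1..n} u (compose {1..n} (\<sigma> f) p) i \<noteq> compose {1..n} f p i))
    \<le> real d * average (fmaps n m) (\<lambda>f. real (card {i\<in>{1..n}. f i \<noteq> u (\<sigma> f i)})) / real n"
proof -
  let ?M = "average (fmaps n m) (\<lambda>f. real (card {i\<in>{1..n}. f i \<noteq> u (\<sigma> f i)})) / real n"
  have pos: "?M \<ge> 0" by (simp add: average_def sum_nonneg)
  have "average (fmaps n m \<times> perms n)
      (\<lambda>(f, p). \<Sum>i\<in>S'. of_bool (compose {1..n} u (compose {1..n} (\<sigma> f) p) i \<noteq> compose {1..n} f p i))
    = (\<Sum>i\<in>S'. average (fmaps n m) (\<lambda>f. average (perms n)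
        (\<lambda>p. of_bool (compose {1..n} u (compose {1..n} (\<sigma> f) p) i \<noteq> compose {1..n} f p i)))) "
    by (simp add: average_times average_sum)
  also have "\<dots> = (\<Sum>i\<in>S'. ?M)"
  proof (rule sum.cong[OF refl])
    fix i assume "i \<in> S'"
    then have i: "i \<in> {1..n}" using S by blast
    have "average (fmaps n m) (\<lambda>f. average (perms n)
        (\<lambda>p. of_bool (compose {1..n} u (compose {1..n} (\<sigma> f) p) i \<noteq> compose {1..n} f p i) :: real))
      = average (fmaps n m) (\<lambda>f. average {1..n} (\<lambda>j. of_bool (f j \<noteq> u (\<sigma> f j))))"
    proof (rule average_cong)
      fix f
      have "average (perms n)
          (\<lambda>p. of_bool (compose {1..n} u (compose {1..n} (\<sigma> f) p) i \<noteq> compose {1..n} f p i) :: real)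
        = average (perms n) (\<lambda>p. of_bool (f (p i) \<noteq> u (\<sigma> f (p i))))"
        using i by (intro average_cong) (auto simp: compose_def)
      then show "average (perms n)
          (\<lambda>p. of_bool (compose {1..n} u (compose {1..n} (\<sigma> f) p) i \<noteq> compose {1..n} f p i) :: real)
        = average {1..n} (\<lambda>j. of_bool (f j \<noteq> u (\<sigma> f j)))"
        by (simp only: average_perms_eval[OF i, where h="\<lambda>j. of_bool (f j \<noteq> u (\<sigma> f j))"])
    qed
    also have "\<dots> = ?M"
      by (simp add: average_def sum_distrib_left[symmetric] sum_distrib_right[symmetric] of_bool_def
          sum.If_cases Int_def divide_inverse mult_ac)
    finally show "average (fmaps n m) (\<lambda>f. average (perms n)
        (\<lambda>p. of_bool (compose {1..n} u (compose {1..n} (\<sigma> f) p) i \<noteq> compose {1..n} f p i) :: real)) = ?M" .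
  qed
  also have "\<dots> \<le> real d * ?M"
    unfolding sum_constant by (rule mult_right_mono[OF of_nat_mono[OF S(2)] pos])
  finally show ?thesis by simp
qed

text \<open>The coupling \<open>(\<tau>(equipart \<circ> \<sigma> f \<circ> p) X, \<tau>(f \<circ> p) X)\<close>, for uniform \<open>f\<close> and \<open>p\<close>: the first component
  has the right law because that of \<open>X\<close> is invariant under \<open>\<sigma> f \<circ> p\<close>, the second because \<open>f \<circ> p\<close> is
  again uniform.\<close>

lemma W1_bound:
  assumes n: "n > 0" and m: "m > 0" and dvd: "m dvd n" and \<mu>: "\<mu> \<in> inv_probs \<tau> \<Omega> n"
    and int: "integrable \<mu> (N1 n)"
  shows "W1 (N1 m) (det_law \<tau> \<Omega> n m (equipart m n) \<mu>) (rand_law \<tau> \<Omega> n m \<mu>)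
    \<le> ennreal (2 * real d * sqrt (real m * (real m - 1) / (real n / real m)) * (LINT x|\<mu>. N1 n x))"
proof -
  note b = inv_probs_D(1)[OF \<mu>]
  interpret \<mu>: prob_space \<mu> by (rule borel_probs_D(1)[OF b])
  let ?q = "equipart m n" and ?I = "fmaps n m \<times> perms n" and ?B = "borel_on (\<Omega> m)"
  have q: "?q \<in> fmaps n m" by (rule equipart_fmaps[OF m n dvd])
  obtain \<sigma> where \<sigma>: "\<And>f. f \<in> fmaps n m \<Longrightarrow> \<sigma> f \<in> perms n"
    and mism: "average (fmaps n m) (\<lambda>f. real (card {i\<in>{1..n}. f i \<noteq> ?q (\<sigma> f i)})) \<le> sqrt (real n * (real m - 1))"
    using exists_close_equiparts[OF m n dvd] by blast
  define a where "a = (\<lambda>(f, p). compose {1..n} ?q (compose {1..n} (\<sigma> f) p))"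
  define c :: "(nat \<Rightarrow> nat) \<times> (nat \<Rightarrow> nat) \<Rightarrow> nat \<Rightarrow> nat"
    where "c = (\<lambda>(f, p). compose {1..n} f p)"
  have I: "finite ?I" "?I \<noteq> {}" using fmaps_nonempty[OF m] perms_nonempty by auto
  have sp: "compose {1..n} (\<sigma> f) p \<in> perms n" if "(f, p) \<in> ?I" for f p
    using that \<sigma> by (intro compose_perms) auto
  have a: "a i \<in> fmaps n m" if "i \<in> ?I" for i
    using compose_fmaps[OF perms_fmaps[OF sp[of "fst i" "snd i"]] q] that
    by (simp add: a_def case_prod_beta)
  have c: "c i \<in> fmaps n m" if "i \<in> ?I" for i
    using that compose_fmaps perms_fmaps by (fastforce simp: c_def)
  define G where "G i x = (\<tau> n m (a i) x, \<tau> n m (c i) x)" for i x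
  have G: "G i \<in> \<mu> \<rightarrow>\<^sub>M ?B \<Otimes>\<^sub>M ?B" if "i \<in> ?I" for i
    unfolding G_def using tau_measurable[OF b n m a[OF that]] tau_measurable[OF b n m c[OF that]]
    by (rule measurable_Pair)
  let ?P = "uniform_count_measure ?I \<Otimes>\<^sub>M \<mu>" and ?G = "\<lambda>(i, x). G i x"
  have Gm: "?G \<in> ?P \<rightarrow>\<^sub>M ?B \<Otimes>\<^sub>M ?B" by (rule measurable_uniform_count_pair[OF I(1) G])
  interpret P: prob_space ?P by (rule prob_space_uniform_count_pair[OF I \<mu>.prob_space_axioms])
  define \<pi> where "\<pi> = distr ?P (?B \<Otimes>\<^sub>M ?B) ?G"
  let ?det = "det_law \<tau> \<Omega> n m ?q \<mu>" and ?rand = "rand_law \<tau> \<Omega> n m \<mu>"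
  have det: "?det \<in> borel_probs (\<Omega> m)" by (rule det_law_borel_probs[OF b n m q])
  have rand: "?rand \<in> borel_probs (\<Omega> m)" by (rule rand_law_borel_probs[OF b n m])
  \<comment> \<open>Covers both marginals. \<open>couplings\<close> uses the marginal law itself as
    target of \<open>distr\<close>, where only its sigma-algebra counts; hence the free
    \<open>N\<close>.\<close>
  have marginal: "distr \<pi> N h = \<nu>"
    if h: "h \<in> ?B \<Otimes>\<^sub>M ?B \<rightarrow>\<^sub>M ?B" and N: "sets N = sets ?B" and \<nu>: "\<nu> \<in> borel_probs (\<Omega> m)"
      and k: "\<And>i x. h (G i x) = \<tau> n m (k i) x" "\<And>i. i \<in> ?I \<Longrightarrow> k i \<in> fmaps n m"
      and avg: "\<And>B. B \<in> sets ?B \<Longrightarrow> average ?I (\<lambda>i. measure (det_law \<tau> \<Omega> n m (k i) \<mu>) B) = measure \<nu> B"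
    for N h k \<nu>
  proof -
    have "distr \<pi> N h = distr \<pi> ?B h" by (rule distr_cong) (use N in auto)
    also have "\<dots> = distr ?P ?B (h \<circ> ?G)" unfolding \<pi>_def by (rule distr_distr[OF h Gm])
    also have "\<dots> = distr ?P ?B (\<lambda>(i, x). \<tau> n m (k i) x)"
      by (rule distr_cong) (auto simp: k(1))
    also have "\<dots> = \<nu>"
    proof (rule borel_probs_eqI[OF _ \<nu>])
      have km: "(\<lambda>(i, x). \<tau> n m (k i) x) \<in> ?P \<rightarrow>\<^sub>M ?B"
        by (rule measurable_uniform_count_pair[OF I(1) tau_measurable[OF b n m k(2)]])
      show "distr ?P ?B (\<lambda>(i, x). \<tau> n m (k i) x) \<in> borel_probs (\<Omega> m)"
        using P.prob_space_distr[OF km] by (simp add: borel_probs_def)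
      fix B assume B: "B \<in> sets ?B"
      have "measure (distr ?P ?B (\<lambda>(i, x). \<tau> n m (k i) x)) B
          = average ?I (\<lambda>i. measure (distr \<mu> ?B (\<tau> n m (k i))) B)"
        by (rule measure_distr_uniform_count_pair[OF I \<mu>.prob_space_axioms tau_measurable[OF b n m k(2)] B])
      then show "measure (distr ?P ?B (\<lambda>(i, x). \<tau> n m (k i) x)) B = measure \<nu> B"
        using avg[OF B] by (simp add: det_law_def)
    qed
    finally show ?thesis .
  qed
  have "distr \<pi> ?det fst = ?det"
  proof (rule marginal[OF measurable_fst borel_probs_D(2)[OF det] det _ a])
    fix B assume "B \<in> sets ?B"
    have "average ?I (\<lambda>i. measure (det_law \<tau> \<Omega> n m (a i) \<mu>) B) = average ?I (\<lambda>i. measure ?det B)"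
    proof (rule average_cong)
      fix i assume "i \<in> ?I"
      then obtain f p where i: "i = (f, p)" "(f, p) \<in> ?I" by (cases i) auto
      note s = sp[OF i(2)]
      show "measure (det_law \<tau> \<Omega> n m (a i) \<mu>) B = measure ?det B"
        using det_law_compose[OF b n n m perms_fmaps[OF s] q] inv_probs_D(2)[OF \<mu> s]
        by (simp add: a_def i(1))
    qed
    also have "\<dots> = measure ?det B" by (rule average_const[OF I])
    finally show "average ?I (\<lambda>i. measure (det_law \<tau> \<Omega> n m (a i) \<mu>) B) = measure ?det B" .
  qed (simp_all add: G_def)
  moreover have "distr \<pi> ?rand snd = ?rand"
  proof (rule marginal[OF measurable_snd borel_probs_D(2)[OF rand] rand _ c])
    fix B assume B: "B \<in> sets ?B"
    let ?\<phi> = "\<lambda>f. measure (det_law \<tau> \<Omega> n m f \<mu>) B"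
    have "average ?I (\<lambda>i. ?\<phi> (c i)) = average (perms n) (\<lambda>p. average (fmaps n m) (\<lambda>f. ?\<phi> (compose {1..n} f p)))"
      unfolding average_times c_def by (subst average_swap) simp
    also have "\<dots> = average (perms n) (\<lambda>p. measure ?rand B)"
    proof (rule average_cong)
      fix p assume p: "p \<in> perms n"
      have "inj_on p {1..n}" using p by (simp add: perms_def bij_betw_def)
      from equifibred_precompose[OF perms_fmaps[OF p] this]
      show "average (fmaps n m) (\<lambda>f. ?\<phi> (compose {1..n} f p)) = measure ?rand B"
        unfolding measure_rand_law[OF b n m B]
        by (rule equifibred_average[OF finite_fmaps finite_fmaps fmaps_nonempty[OF m]])
    qed
    also have "\<dots> = measure ?rand B" by (rule average_const[OF finite_perms perms_nonempty])
    finally show "average ?I (\<lambda>i. ?\<phi> (c i)) = measure ?rand B" .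
  qed (simp_all add: G_def)
  moreover have "sets \<pi> = sets (?det \<Otimes>\<^sub>M ?rand)"
    unfolding \<pi>_def by (simp add: sets_pair_measure_cong[OF borel_probs_D(2)[OF det] borel_probs_D(2)[OF rand]])
  moreover have "prob_space \<pi>" unfolding \<pi>_def by (rule P.prob_space_distr[OF Gm])
  ultimately have \<pi>: "\<pi> \<in> couplings ?det ?rand" by (simp add: couplings_def)

  let ?S = "\<lambda>i \<alpha>. \<Sum>s\<in>S n \<alpha>. of_bool (a i s \<noteq> c i s) :: real"
  let ?h = "\<lambda>i x. N1 m (\<tau> n m (a i) x - \<tau> n m (c i) x)"
  \<comment> \<open>\<open>?g\<close> dominates \<open>?h\<close> and separates the two sources of
    randomness: the coordinates depend on x alone and the mismatches on i = (f, p) alone, so their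
    means multiply.\<close>
  let ?g = "\<lambda>i x. \<Sum>\<alpha>\<in>A n. \<bar>x \<bullet> dual n \<alpha>\<bar> * (2 * ?S i \<alpha>)"
  have g_int: "integrable \<mu> (?g i)" for i
    by (intro Bochner_Integration.integrable_sum integrable_mult_left integrable_abs integrable_coord[OF b n int])
  have xV: "x \<in> V n" if "x \<in> space \<mu>" for x
    using that Omega_V[OF n] by (auto simp: borel_probs_D(3)[OF b])
  \<comment> \<open>The inner product formula for the norm is available on \<open>V m\<close>, which
    contains the differences of points of \<open>\<Omega> m\<close>.\<close>
  have h_meas: "(\<lambda>z. N1 m (fst z - snd z)) \<in> borel_measurable (?B \<Otimes>\<^sub>M ?B)"
  proof (subst measurable_cong)
    fix z assume "z \<in> space (?B \<Otimes>\<^sub>M ?B)"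
    then have "fst z - snd z \<in> V m"
      using Omega_V[OF m] by (intro subspace_diff subspace_V m) (auto simp: space_pair_measure space_restrict_space)
    then show "N1 m (fst z - snd z) = (\<Sum>\<alpha>\<in>A m. \<bar>(fst z - snd z) \<bullet> dual m \<alpha>\<bar>)" by (rule N1_eq[OF m])
  next
    have [measurable]: "id \<in> ?B \<rightarrow>\<^sub>M borel" by (rule measurable_restrict_space1) simp
    have [measurable]: "(\<lambda>z. fst z) \<in> ?B \<Otimes>\<^sub>M ?B \<rightarrow>\<^sub>M borel" "(\<lambda>z. snd z) \<in> ?B \<Otimes>\<^sub>M ?B \<rightarrow>\<^sub>M borel"
      using measurable_compose[OF measurable_fst \<open>id \<in> _\<close>] measurable_compose[OF measurable_snd \<open>id \<in> _\<close>]
      by (simp_all add: id_def)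
    show "(\<lambda>z. \<Sum>\<alpha>\<in>A m. \<bar>(fst z - snd z) \<bullet> dual m \<alpha>\<bar>) \<in> borel_measurable (?B \<Otimes>\<^sub>M ?B)" by measurable
  qed
  have h_le: "?h i x \<le> ?g i x" if "i \<in> ?I" "x \<in> space \<mu>" for i x
    using that by (intro N1_tau_diff n m a c xV)
  have h_int: "integrable \<mu> (?h i)" if i: "i \<in> ?I" for i
  proof (rule Bochner_Integration.integrable_bound[OF g_int[of i]])
    show "?h i \<in> borel_measurable \<mu>"
      using measurable_compose[OF G[OF i] h_meas] by (simp add: G_def)
    show "AE x in \<mu>. norm (?h i x) \<le> norm (?g i x)"
      using h_le[OF i] by (intro AE_I2) (simp add: N1_nonneg abs_of_nonneg sum_nonneg)
  qed
  have H: "integrable ?P (\<lambda>z. ?h (fst z) (snd z))"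
    "(LINT z|?P. ?h (fst z) (snd z)) = average ?I (\<lambda>i. LINT x|\<mu>. ?h i x)"
    using integral_uniform_count_pair[OF I \<mu>.prob_space_axioms, of "\<lambda>z. ?h (fst z) (snd z)"] h_int by simp_all
  have "W1 (N1 m) ?det ?rand \<le> (\<integral>\<^sup>+ (x, y). ennreal (N1 m (x - y)) \<partial>\<pi>)"
    unfolding W1_def by (rule INF_lower[OF \<pi>])
  also have "\<dots> = (\<integral>\<^sup>+ z. ennreal (N1 m (fst z - snd z)) \<partial>\<pi>)" by (simp add: case_prod_unfold)
  also have "\<dots> = (\<integral>\<^sup>+ z. ennreal (?h (fst z) (snd z)) \<partial>?P)"
    unfolding \<pi>_def using h_meas
    by (subst nn_integral_distr[OF Gm]) (auto simp: G_def case_prod_beta)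
  also have "\<dots> = ennreal (LINT z|?P. ?h (fst z) (snd z))"
    by (rule nn_integral_eq_integral[OF H(1)]) (simp add: N1_nonneg)
  also have "\<dots> = ennreal (average ?I (\<lambda>i. LINT x|\<mu>. ?h i x))" by (simp only: H(2))
  also have "\<dots> \<le> ennreal (2 * real d * sqrt (real m * (real m - 1) / (real n / real m)) * (LINT x|\<mu>. N1 n x))"
  proof (rule ennreal_leI)
    have "average ?I (\<lambda>i. LINT x|\<mu>. ?h i x) \<le> average ?I (\<lambda>i. LINT x|\<mu>. ?g i x)"
      by (intro average_mono integral_mono h_int g_int h_le)
    also have "\<dots> = average ?I (\<lambda>i. \<Sum>\<alpha>\<in>A n. (LINT x|\<mu>. \<bar>x \<bullet> dual n \<alpha>\<bar>) * (2 * ?S i \<alpha>))"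
    proof (rule average_cong)
      fix i
      have "(LINT x|\<mu>. ?g i x) = (\<Sum>\<alpha>\<in>A n. LINT x|\<mu>. \<bar>x \<bullet> dual n \<alpha>\<bar> * (2 * ?S i \<alpha>))"
        by (intro Bochner_Integration.integral_sum integrable_mult_left integrable_abs integrable_coord[OF b n int])
      then show "(LINT x|\<mu>. ?g i x) = (\<Sum>\<alpha>\<in>A n. (LINT x|\<mu>. \<bar>x \<bullet> dual n \<alpha>\<bar>) * (2 * ?S i \<alpha>))"
        by simp
    qed
    also have "\<dots> = (\<Sum>\<alpha>\<in>A n. (LINT x|\<mu>. \<bar>x \<bullet> dual n \<alpha>\<bar>) * (2 * average ?I (\<lambda>i. ?S i \<alpha>)))"
      by (simp only: average_sum average_mult_left)
    also have "\<dots> \<le> (\<Sum>\<alpha>\<in>A n. (LINT x|\<mu>. \<bar>x \<bullet> dual n \<alpha>\<bar>) * (2 * (real d * sqrt (real n * (real m - 1)) / real n)))"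
    proof (intro sum_mono mult_left_mono Bochner_Integration.integral_nonneg)
      fix \<alpha> assume \<alpha>: "\<alpha> \<in> A n"
      have "average ?I (\<lambda>i. ?S i \<alpha>) \<le>
          real d * average (fmaps n m) (\<lambda>f. real (card {i\<in>{1..n}. f i \<noteq> ?q (\<sigma> f i)})) / real n"
        using average_mismatch[of "S n \<alpha>" n m ?q \<sigma>] supp[OF n \<alpha>]
        by (simp add: a_def c_def case_prod_unfold)
      also have "\<dots> \<le> real d * sqrt (real n * (real m - 1)) / real n"
        using mism by (intro divide_right_mono mult_left_mono) auto
      finally show "average ?I (\<lambda>i. ?S i \<alpha>) \<le> real d * sqrt (real n * (real m - 1)) / real n" .
    qed auto
    also have "\<dots> = 2 * real d * (sqrt (real n * (real m - 1)) / real n) * (LINT x|\<mu>. N1 n x)"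
      by (simp add: integral_N1[OF b n int] sum_distrib_left sum_divide_distrib mult_ac)
    \<comment> \<open>So far the constant is 2d sqrt((m-1)/n). The stated one is m times as large,
      and m is at least 1.\<close>
    also have "\<dots> \<le> 2 * real d * sqrt (real m * (real m - 1) / (real n / real m)) * (LINT x|\<mu>. N1 n x)"
    proof (intro mult_right_mono mult_left_mono Bochner_Integration.integral_nonneg N1_nonneg)
      have "sqrt (real n * (real m - 1)) / real n = sqrt (real n * (real m - 1) / (real n)\<^sup>2)"
        by (simp add: real_sqrt_divide)
      also have "real n * (real m - 1) / (real n)\<^sup>2 = (real m - 1) / real n"
        using n by (simp add: power2_eq_square)
      also have "sqrt \<dots> \<le> sqrt (real m * real m * (real m - 1) / real n)"
      proof (intro real_sqrt_le_mono divide_right_mono)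
        have "1 * 1 * (real m - 1) \<le> real m * real m * (real m - 1)"
          using m by (intro mult_right_mono mult_mono) auto
        then show "real m - 1 \<le> real m * real m * (real m - 1)" by simp
      qed simp
      also have "real m * real m * (real m - 1) / real n = real m * (real m - 1) / (real n / real m)"
        by (simp add: mult_ac)
      finally show "sqrt (real n * (real m - 1)) / real n \<le> sqrt (real m * (real m - 1) / (real n / real m))" .
    qed auto
    finally show "average ?I (\<lambda>i. LINT x|\<mu>. ?h i x)
      \<le> 2 * real d * sqrt (real m * (real m - 1) / (real n / real m)) * (LINT x|\<mu>. N1 n x)" .
  qed
  finally show ?thesis .
qed

section \<open>Density of the image\<close>

lemma integrable_N1_bounded:
  assumes \<mu>: "\<mu> \<in> borel_probs (\<Omega> n)" and n: "n > 0" and C: "\<And>x. x \<in> \<Omega> n \<Longrightarrow> N1 n x \<le> C"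
  shows "integrable \<mu> (N1 n)" "(LINT x|\<mu>. N1 n x) \<le> C"
proof -
  interpret prob_space \<mu> by (rule borel_probs_D(1)[OF \<mu>])
  show int: "integrable \<mu> (N1 n)"
  proof (rule integrable_const_bound[OF _ N1_measurable[OF \<mu> n]])
    show "AE x in \<mu>. norm (N1 n x) \<le> C"
    proof (rule AE_I2)
      fix x assume "x \<in> space \<mu>"
      then show "norm (N1 n x) \<le> C"
        using C[of x] N1_nonneg[of n x] by (simp add: borel_probs_D(3)[OF \<mu>])
    qed
  qed
  show "(LINT x|\<mu>. N1 n x) \<le> C"
    by (rule integral_le_const[OF int], rule AE_I2, rule C) (simp add: borel_probs_D(3)[OF \<mu>])
qed

text \<open>One sequence must serve all \<open>m\<close> at once. As soon as \<open>m\<close>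
  divides i!, the member of the family at level i! projects exactly to \<open>\<mu> m\<close>, so
  the error bound compares \<open>\<mu> m\<close> itself with an element of the image, and the
  uniform bound \<open>C\<close> takes the place of the mean norm.\<close>

lemma dense_image:
  assumes C: "\<And>n x. n > 0 \<Longrightarrow> x \<in> \<Omega> n \<Longrightarrow> N1 n x \<le> C" and \<mu>: "\<mu> \<in> proj_lim \<tau> \<Omega>" and m: "m > 0"
  shows "(\<lambda>i. W1 (N1 m) (\<mu> m) (rand_seq \<tau> \<Omega> (fact i) (\<mu> (fact i)) m)) \<longlonglongrightarrow> 0"
proof (rule tendsto_sandwich[OF _ _ tendsto_const])
  have inv: "\<mu> n \<in> inv_probs \<tau> \<Omega> n" if "n > 0" for n
    using \<mu> that by (auto simp: proj_lim_def PiE_iff)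
  let ?b = "\<lambda>i. 2 * real d * sqrt (real m * (real m - 1) / (fact i / real m)) * C"
  show "\<forall>\<^sub>F i in sequentially. 0 \<le> W1 (N1 m) (\<mu> m) (rand_seq \<tau> \<Omega> (fact i) (\<mu> (fact i)) m)" by simp
  have "W1 (N1 m) (\<mu> m) (rand_seq \<tau> \<Omega> (fact i) (\<mu> (fact i)) m) \<le> ennreal (?b i)" if "i \<ge> m" for i
  proof -
    have n: "(fact i :: nat) > 0" by simp
    have dvd: "m dvd fact i" using m that by (intro dvd_fact) auto
    have det: "det_law \<tau> \<Omega> (fact i) m (equipart m (fact i)) (\<mu> (fact i)) = \<mu> m"
      using \<mu> m n dvd unfolding proj_lim_def by blast
    note int = integrable_N1_bounded[OF inv_probs_D(1)[OF inv[OF n]] n C[OF n]]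
    have "W1 (N1 m) (\<mu> m) (rand_law \<tau> \<Omega> (fact i) m (\<mu> (fact i)))
        \<le> ennreal (2 * real d * sqrt (real m * (real m - 1) / (real (fact i) / real m)) * (LINT x|\<mu> (fact i). N1 (fact i) x))"
      using W1_bound[OF n m dvd inv[OF n] int(1)] unfolding det .
    also have "\<dots> \<le> ennreal (?b i)"
      using m by (intro ennreal_leI) (auto intro!: mult_left_mono int(2))
    finally show ?thesis using m by (simp add: rand_seq_def)
  qed
  then show "\<forall>\<^sub>F i in sequentially. W1 (N1 m) (\<mu> m) (rand_seq \<tau> \<Omega> (fact i) (\<mu> (fact i)) m) \<le> ennreal (?b i)"
    by (rule eventually_sequentiallyI)
  \<comment> \<open>These are the terms of the exponential series at 1.\<close>
  have "(\<lambda>i. inverse (fact i) :: real) \<longlonglongrightarrow> 0"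
    using summable_LIMSEQ_zero[OF summable_exp[of "1 :: real"]] by simp
  then have "(\<lambda>i. real m * (real m - 1) * real m * inverse (fact i)) \<longlonglongrightarrow> 0"
    by (rule tendsto_mult_right_zero)
  then have "(\<lambda>i. real m * (real m - 1) / (fact i / real m)) \<longlonglongrightarrow> 0"
    by (simp add: divide_inverse mult_ac)
  then have "?b \<longlonglongrightarrow> 2 * real d * sqrt 0 * C" by (intro tendsto_intros)
  then show "(\<lambda>i. ennreal (?b i)) \<longlonglongrightarrow> 0"
    using tendsto_ennrealI[of ?b 0] by simp
qed

end

theorem theorem4p20:
  fixes V \<Omega> :: "nat \<Rightarrow> 'a::{real_inner, banach, second_countable_topology} set"
    and \<tau> :: "nat \<Rightarrow> nat \<Rightarrow> (nat \<Rightarrow> nat) \<Rightarrow> 'a \<Rightarrow> 'a"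
    and A :: "nat \<Rightarrow> 'i set"
    and e :: "nat \<Rightarrow> 'i \<Rightarrow> 'a"
    and S :: "nat \<Rightarrow> 'i \<Rightarrow> nat set"
    and d :: nat
  assumes rep: "finset_rep V \<tau>"
    and basis: "\<And>n. n > 0 \<Longrightarrow> basis_of (A n) (e n) (V n)"
    and supp: "\<And>n \<alpha>. n > 0 \<Longrightarrow> \<alpha> \<in> A n \<Longrightarrow> S n \<alpha> \<subseteq> {1..n} \<and> card (S n \<alpha>) \<le> d"
    and local_dep: "\<And>n m f h \<alpha>. n > 0 \<Longrightarrow> m > 0 \<Longrightarrow> f \<in> fmaps n m \<Longrightarrow> h \<in> fmaps n m \<Longrightarrow>
      \<alpha> \<in> A n \<Longrightarrow> (\<forall>i\<in>S n \<alpha>. f i = h i) \<Longrightarrow> \<tau> n m f (e n \<alpha>) = \<tau> n m h (e n \<alpha>)"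
    and contr: "\<And>n m f \<alpha>. n > 0 \<Longrightarrow> m > 0 \<Longrightarrow> f \<in> fmaps n m \<Longrightarrow> \<alpha> \<in> A n \<Longrightarrow>
      l1_norm (A m) (e m) (\<tau> n m f (e n \<alpha>)) \<le> 1"
    and Omega_compact: "\<And>n. n > 0 \<Longrightarrow> \<Omega> n \<subseteq> V n \<and> compact (\<Omega> n)"
    and Omega_maps: "\<And>n m f. n > 0 \<Longrightarrow> m > 0 \<Longrightarrow> f \<in> fmaps m n \<Longrightarrow> \<tau> m n f ` \<Omega> m \<subseteq> \<Omega> n"
    and Omega_bounded: "\<exists>C. \<forall>n>0. \<forall>x\<in>\<Omega> n. l1_norm (A n) (e n) x \<le> C"
  shows
    \<comment> \<open>the map is well defined on classes and takes values in the projective limit\<close>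
    "(\<forall>n>0. \<forall>\<mu>\<in>inv_probs \<tau> \<Omega> n. lim_map \<tau> \<Omega> (ind_class \<tau> \<Omega> n \<mu>) = rand_seq \<tau> \<Omega> n \<mu>)
     \<and> lim_map \<tau> \<Omega> \<in> ind_lim \<tau> \<Omega> \<rightarrow> proj_lim \<tau> \<Omega>
     \<and> (\<forall>\<mu>\<in>proj_lim \<tau> \<Omega>. \<exists>\<nu>. (\<forall>i::nat. \<nu> i \<in> lim_map \<tau> \<Omega> ` ind_lim \<tau> \<Omega>) \<and>
          (\<forall>m>0. (\<lambda>i. W1 (l1_norm (A m) (e m)) (\<mu> m) (\<nu> i m)) \<longlonglongrightarrow> 0))
     \<and> (\<forall>n>0. \<forall>m>0. \<forall>\<mu>\<in>inv_probs \<tau> V n. m dvd n \<longrightarrow> integrable \<mu> (l1_norm (A n) (e n)) \<longrightarrow>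
          W1 (l1_norm (A m) (e m)) (det_law \<tau> V n m (equipart m n) \<mu>) (rand_law \<tau> V n m \<mu>)
            \<le> ennreal (2 * real d * sqrt (real m * (real m - 1) / (real n / real m))
                * (LINT x|\<mu>. l1_norm (A n) (e n) x)) \<and>
          l1_norm (A m) (e m)
             ((LINT x|\<mu>. \<tau> n m (equipart m n) x)
              - (LINT (f, x)|(uniform_count_measure (fmaps n m) \<Otimes>\<^sub>M \<mu>). \<tau> n m f x))
            \<le> real d * (real d - 1) / real n * (LINT x|\<mu>. l1_norm (A n) (e n) x))"
proof -
  interpret local_finset_rep V \<tau> A e S d
    by (intro local_finset_rep.intro local_finset_rep_axioms.intro rep basis supp local_dep contr)
  \<comment> \<open>\<open>O\<close> carries the statements about the limits, \<open>W\<close> the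
    error bounds for measures on all of \<open>V n\<close>.\<close>
  interpret O: local_finset_rep_on V \<tau> A e S d \<Omega>
    by unfold_locales (use Omega_compact Omega_maps in blast)+
  interpret W: local_finset_rep_on V \<tau> A e S d V
    by unfold_locales (use maps_to in blast)+
  obtain C where C: "\<And>n x. n > 0 \<Longrightarrow> x \<in> \<Omega> n \<Longrightarrow> l1_norm (A n) (e n) x \<le> C"
    using Omega_bounded by blast
  have dense: "\<exists>\<nu>. (\<forall>i::nat. \<nu> i \<in> lim_map \<tau> \<Omega> ` ind_lim \<tau> \<Omega>) \<and>
          (\<forall>m>0. (\<lambda>i. W1 (l1_norm (A m) (e m)) (\<mu> m) (\<nu> i m)) \<longlonglongrightarrow> 0)"
    if \<mu>: "\<mu> \<in> proj_lim \<tau> \<Omega>" for \<mu>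
  proof (intro exI[of _ "\<lambda>i. rand_seq \<tau> \<Omega> (fact i) (\<mu> (fact i))"] conjI allI impI)
    fix i :: nat
    have "\<mu> (fact i) \<in> inv_probs \<tau> \<Omega> (fact i)"
      using \<mu> by (auto simp: proj_lim_def PiE_iff)
    then show "rand_seq \<tau> \<Omega> (fact i) (\<mu> (fact i)) \<in> lim_map \<tau> \<Omega> ` ind_lim \<tau> \<Omega>"
      by (intro O.rand_seq_in_image) simp_all
  qed (rule O.dense_image[OF C \<mu>])
  show ?thesis
    by (intro conjI allI ballI impI O.lim_map_ind_class O.lim_map_proj_lim dense W.W1_bound W.expectation_bound)
qed

end
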